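(* Let $Q$ be a finite left automorphic Moufang loop, $S\le Q$, and $x,y\in Q$ such that $xS\cap yS\neq\emptyset$. Then $|xS\cap yS|=|T|$ for some subloop $T$ of $S$. In particular, $|xS\cap yS|$ divides $|S|$.
   Context: A Moufang loop is a loop satisfying $((xy)x)z=x(y(xz))$. A loop is left automorphic if every left inner mapping (element of the stabilizer of $1$ in the group generated by the left translations $L_x:y\mapsto xy$) is an automorphism. $xS=\{xs:s\in S\}$. *)

theory Defs
  imports Main
begin

definition loop :: "'a set \<Rightarrow> ('a \<Rightarrow> 'a \<Rightarrow> 'a) \<Rightarrow> 'a \<Rightarrow> bool" where
  "loop Q m e \<longleftrightarrow> e \<in> Q \<and> (\<forall>a\<in>Q. \<forall>b\<in>Q. m a b \<in> Q)
     \<and> (\<forall>a\<in>Q. m e a = a \<and> m a e = a)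
     \<and> (\<forall>a\<in>Q. \<forall>b\<in>Q. \<exists>!z. z \<in> Q \<and> m a z = b)
     \<and> (\<forall>a\<in>Q. \<forall>b\<in>Q. \<exists>!z. z \<in> Q \<and> m z a = b)"

definition ldiv :: "'a set \<Rightarrow> ('a \<Rightarrow> 'a \<Rightarrow> 'a) \<Rightarrow> 'a \<Rightarrow> 'a \<Rightarrow> 'a" where
  "ldiv Q m a b = (THE z. z \<in> Q \<and> m a z = b)"

definition rdiv :: "'a set \<Rightarrow> ('a \<Rightarrow> 'a \<Rightarrow> 'a) \<Rightarrow> 'a \<Rightarrow> 'a \<Rightarrow> 'a" where
  "rdiv Q m b a = (THE z. z \<in> Q \<and> m z a = b)"

definition moufang :: "'a set \<Rightarrow> ('a \<Rightarrow> 'a \<Rightarrow> 'a) \<Rightarrow> bool" where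
  "moufang Q m \<longleftrightarrow> (\<forall>x\<in>Q. \<forall>y\<in>Q. \<forall>z\<in>Q. m (m (m x y) x) z = m x (m y (m x z)))"

definition subloop :: "'a set \<Rightarrow> ('a \<Rightarrow> 'a \<Rightarrow> 'a) \<Rightarrow> 'a \<Rightarrow> 'a set \<Rightarrow> bool" where
  "subloop Q m e S \<longleftrightarrow> S \<subseteq> Q \<and> e \<in> S
     \<and> (\<forall>a\<in>S. \<forall>b\<in>S. m a b \<in> S \<and> ldiv Q m a b \<in> S \<and> rdiv Q m a b \<in> S)"

text \<open>The left multiplication group: generated (under composition) by the left translations
  L_x and their inverses L_x^{-1} = ldiv x, as maps on Q.\<close>
inductive_set lmlt :: "'a set \<Rightarrow> ('a \<Rightarrow> 'a \<Rightarrow> 'a) \<Rightarrow> ('a \<Rightarrow> 'a) set"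
  for Q m where
  lmlt_id: "(\<lambda>y. y) \<in> lmlt Q m"
| lmlt_L: "f \<in> lmlt Q m \<Longrightarrow> x \<in> Q \<Longrightarrow> (\<lambda>y. m x (f y)) \<in> lmlt Q m"
| lmlt_Linv: "f \<in> lmlt Q m \<Longrightarrow> x \<in> Q \<Longrightarrow> (\<lambda>y. ldiv Q m x (f y)) \<in> lmlt Q m"

definition automorphism :: "'a set \<Rightarrow> ('a \<Rightarrow> 'a \<Rightarrow> 'a) \<Rightarrow> ('a \<Rightarrow> 'a) \<Rightarrow> bool" where
  "automorphism Q m f \<longleftrightarrow> bij_betw f Q Q \<and> (\<forall>a\<in>Q. \<forall>b\<in>Q. f (m a b) = m (f a) (f b))"

definition left_automorphic :: "'a set \<Rightarrow> ('a \<Rightarrow> 'a \<Rightarrow> 'a) \<Rightarrow> 'a \<Rightarrow> bool" where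
  "left_automorphic Q m e \<longleftrightarrow> (\<forall>f\<in>lmlt Q m. f e = e \<longrightarrow> automorphism Q m f)"

definition lcoset :: "('a \<Rightarrow> 'a \<Rightarrow> 'a) \<Rightarrow> 'a \<Rightarrow> 'a set \<Rightarrow> 'a set" where
  "lcoset m x S = (\<lambda>s. m x s) ` S"

end

theory Submission
  imports Defs "HOL-Algebra.Sylow" "HOL-Algebra.Group_Action" "HOL-Algebra.Multiplicative_Group"
    "HOL-Algebra.Generated_Groups" "HOL-Combinatorics.Permutations"
begin

text \<open>If $z = xs = yt$ with $s, t \in S$, then $L_z^{-1}L_xL_s$ and $L_z^{-1}L_yL_t$ are left inner
  mappings, hence automorphisms, and $xS \cap yS$ is the $L_z$-image of the intersection of the two
  corresponding images of $S$; pulling back gives a subloop $T$ of $S$.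

  Divisibility is Lagrange's theorem for $T \leq S$. That left inner mappings are automorphisms
  forces all commutators into the nucleus, so $S$ modulo its nucleus is a commutative Moufang loop
  and it is enough to treat the nucleus, which is a group, and such a loop $C$. In $C$ cubing is a
  homomorphism onto an abelian group, so finally one may assume that $C$ has exponent $3$, where it
  remains to see that $|C|$ is a power of $3$. The operation $(xy)^{-1}$ makes $C$ a distributive
  quasigroup whose translations $\sigma_x$ are automorphisms; the products $\sigma_x\sigma_y$
  form a union of conjugacy classes of a group acting transitively on $C$. Two such products involve
  four points, that is, three elements of a loop with one of the points as unit, and three elements
  generate a loop of class at most $2$, so the two products generate a $3$-group. By the Baer--Suzuki
  theorem all the products together generate a $3$-group.\<close>

section \<open>The Baer--Suzuki theorem\<close>

text \<open>The obstacle is that left cosets of a subloop may overlap without being equal, so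
  Lagrange's theorem cannot be had by counting cosets. Each reduction counts instead the fibres of a
  homomorphism, which have constant size on the loop and on every closed subset, until the remaining
  factors are orders of groups or powers of 3. Powers of 3 need only be compared by size, and the
  kernel of cubing on T is contained in that of the whole loop. The prime is 3 because cubes in a
  commutative Moufang loop associate with everything, so that what cubing loses has exponent 3. That
  a loop of exponent 3 has order a power of 3 cannot come from induction over its subloops, which
  would presuppose divisibility; it comes from a 3-group acting transitively on it. Controlling all
  translations at once would require nilpotency for arbitrarily many generators. Baer-Suzuki lowers
  this to two products of two translations, so to four points, and taking one of them as unit leaves
  three, where class 2 is a finite calculation.\<close>

definition p_subgroup :: "nat \<Rightarrow> ('g, 'c) monoid_scheme \<Rightarrow> 'g set \<Rightarrow> bool" where
  "p_subgroup p G H \<longleftrightarrow> subgroup H G \<and> (\<exists>k::nat. \<forall>h\<in>H. h [^]\<^bsub>G\<^esub> (p ^ k) = \<one>\<^bsub>G\<^esub>)"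

lemma nat_prime_power_if_only_prime_divisor:
  fixes n p :: nat
  assumes "n > 0" and "prime p" and only: "\<And>q. prime q \<Longrightarrow> q dvd n \<Longrightarrow> q = p"
  shows "\<exists>a. n = p ^ a"
proof -
  have "\<not> is_unit p" using assms(2) by (simp add: prime_nat_iff)
  then obtain m where m: "n = p ^ multiplicity p n * m" "\<not> p dvd m"
    using assms(1) multiplicity_decompose'[of n p] by (metis neq0_conv)
  have "m = 1"
  proof (rule ccontr)
    assume "m \<noteq> 1"
    then obtain q where "prime q" "q dvd m" using prime_factor_nat by blast
    then have "q = p" using only m(1) by (metis dvd_mult)
    then show False using \<open>q dvd m\<close> m(2) by simp
  qed
  then show ?thesis using m(1) by auto
qed

context group
begin

text \<open>\<open>p_subgroup\<close> bounds an exponent, which passes easily to subgroups and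
  products. Orders come back by Cauchy's theorem, taken from Sylow's with exponent 1: a prime q
  dividing \<open>card H\<close> gives an element of order q, and this order divides
  \<open>p ^ k\<close>.\<close>

lemma card_p_subgroup:
  assumes fin: "finite (carrier G)" and p: "prime p" and H: "p_subgroup p G H"
  shows "\<exists>n. card H = p ^ n"
proof -
  from H obtain k :: nat where sub: "subgroup H G" and k: "\<And>h. h \<in> H \<Longrightarrow> h [^] (p ^ k) = \<one>"
    by (auto simp: p_subgroup_def)
  let ?H = "G\<lparr>carrier := H\<rparr>"
  have grp: "group ?H" using sub by (rule subgroup_imp_group)
  have finH: "finite H" using sub fin by (meson finite_subset subgroup.subset)
  have "card H > 0" using sub finH by (metis card_gt_0_iff empty_iff subgroup.one_closed)
  moreover have "q = p" if q: "prime q" "q dvd card H" for q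
  proof -
    obtain m where "card H = q ^ 1 * m" using q(2) by auto
    then obtain K where K: "subgroup K ?H" "card K = q ^ 1"
      using sylow_thm[OF q(1) grp, of 1 m] finH by (auto simp: order_def)
    have KH: "K \<subseteq> H" using subgroup.subset[OF K(1)] by simp
    have KG: "subgroup K G" using K(1) sub incl_subgroup by blast
    obtain x where x: "x \<in> K" "x \<noteq> \<one>"
    proof -
      have "\<not> K \<subseteq> {\<one>}"
        using K(2) q(1) card_mono[of "{\<one>}" K] by (auto dest: prime_gt_1_nat)
      then show ?thesis using that by auto
    qed
    have xc: "x \<in> carrier G" using x KG by (meson subgroup.mem_carrier)
    interpret K: group "G\<lparr>carrier := K\<rparr>" using KG by (rule subgroup_imp_group)
    have "x [^]\<^bsub>G\<lparr>carrier := K\<rparr>\<^esub> order (G\<lparr>carrier := K\<rparr>) = \<one>\<^bsub>G\<lparr>carrier := K\<rparr>\<^esub>"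
      using K.pow_order_eq_1 x by simp
    then have "x [^] q = \<one>" using K(2) by (simp add: order_def nat_pow_consistent[symmetric])
    then have "ord x dvd q" using xc by (simp add: pow_eq_id)
    moreover have "ord x dvd p ^ k" using k[of x] x KH xc by (auto simp: pow_eq_id[symmetric])
    moreover have "ord x \<noteq> 1" using x xc ord_eq_1 by blast
    ultimately have "q dvd p ^ k" using q(1) prime_nat_iff by auto
    then show ?thesis using p q(1) by (metis prime_dvd_power primes_dvd_imp_eq)
  qed
  ultimately show ?thesis using nat_prime_power_if_only_prime_divisor p by blast
qed

lemma p_subgroup_subset:
  assumes "p_subgroup p G H" "subgroup K G" "K \<subseteq> H"
  shows "p_subgroup p G K"
  using assms by (auto simp: p_subgroup_def)

text \<open>If $K$ normalises $H$ then $(hk)^n \in H k^n$.\<close>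

lemma p_subgroup_mult:
  assumes H: "p_subgroup p G H" and K: "p_subgroup p G K"
    and norm: "\<And>h k. h \<in> H \<Longrightarrow> k \<in> K \<Longrightarrow> k \<otimes> h \<otimes> inv k \<in> H"
  shows "p_subgroup p G (H <#> K)"
proof -
  from H obtain i :: nat where H': "subgroup H G" and i: "\<And>h. h \<in> H \<Longrightarrow> h [^] (p ^ i) = \<one>"
    by (auto simp: p_subgroup_def)
  from K obtain j :: nat where K': "subgroup K G" and j: "\<And>h. h \<in> K \<Longrightarrow> h [^] (p ^ j) = \<one>"
    by (auto simp: p_subgroup_def)
  have [simp]: "h \<in> H \<Longrightarrow> h \<in> carrier G" for h using H' by (rule subgroup.mem_carrier)
  have [simp]: "h \<in> K \<Longrightarrow> h \<in> carrier G" for h using K' by (rule subgroup.mem_carrier)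
  have swap: "\<exists>h'\<in>H. k \<otimes> h = h' \<otimes> k" if "h \<in> H" "k \<in> K" for h k
    using that norm[OF that] by (intro bexI[of _ "k \<otimes> h \<otimes> inv k"]) (auto simp: m_assoc)
  have sub: "subgroup (H <#> K) G"
  proof (rule subgroupI)
    show "H <#> K \<subseteq> carrier G" by (auto simp: set_mult_def)
    show "H <#> K \<noteq> {}"
      using subgroup.one_closed[OF H'] subgroup.one_closed[OF K'] by (auto simp: set_mult_def)
  next
    fix a assume "a \<in> H <#> K"
    then obtain h k where hk: "h \<in> H" "k \<in> K" "a = h \<otimes> k" by (auto simp: set_mult_def)
    obtain h' where "h' \<in> H" "inv k \<otimes> inv h = h' \<otimes> inv k"
      using swap[of "inv h" "inv k"] hk H' K' by (auto simp: subgroup.m_inv_closed)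
    moreover have "inv k \<in> K" using hk K' by (simp add: subgroup.m_inv_closed)
    ultimately show "inv a \<in> H <#> K"
      using hk by (auto simp: set_mult_def inv_mult_group)
  next
    fix a b assume "a \<in> H <#> K" "b \<in> H <#> K"
    then obtain h k h' k' where hk: "h \<in> H" "k \<in> K" "a = h \<otimes> k" "h' \<in> H" "k' \<in> K" "b = h' \<otimes> k'"
      by (auto simp: set_mult_def)
    obtain h'' where h'': "h'' \<in> H" "k \<otimes> h' = h'' \<otimes> k" using swap hk by blast
    have "a \<otimes> b = h \<otimes> (k \<otimes> h') \<otimes> k'" using hk by (simp add: m_assoc)
    also have "\<dots> = (h \<otimes> h'') \<otimes> (k \<otimes> k')" unfolding h''(2) using hk h'' by (simp add: m_assoc)
    finally have "a \<otimes> b = (h \<otimes> h'') \<otimes> (k \<otimes> k')" .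
    moreover have "h \<otimes> h'' \<in> H" "k \<otimes> k' \<in> K" using hk h'' H' K' by (auto simp: subgroup.m_closed)
    ultimately show "a \<otimes> b \<in> H <#> K" unfolding set_mult_def by blast
  qed
  have pow: "\<exists>h'\<in>H. (h \<otimes> k) [^] n = h' \<otimes> k [^] n" if hk: "h \<in> H" "k \<in> K" for h k and n :: nat
  proof (induction n)
    case 0
    show ?case using subgroup.one_closed[OF H'] by auto
  next
    case (Suc n)
    then obtain h' where h': "h' \<in> H" "(h \<otimes> k) [^] n = h' \<otimes> k [^] n" by blast
    have kn: "k [^] n \<in> K" using hk K' by (induction n) (auto simp: subgroup.one_closed subgroup.m_closed)
    obtain h'' where h'': "h'' \<in> H" "k [^] n \<otimes> h = h'' \<otimes> k [^] n" using swap hk kn by blast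
    have "(h \<otimes> k) [^] Suc n = h' \<otimes> (k [^] n \<otimes> h) \<otimes> k"
      using h' hk by (simp add: m_assoc)
    also have "\<dots> = (h' \<otimes> h'') \<otimes> k [^] Suc n" unfolding h''(2) using h' h'' hk by (simp add: m_assoc)
    finally show ?case using h' h'' H' by (auto simp: subgroup.m_closed)
  qed
  have "x [^] (p ^ (j + i)) = \<one>" if "x \<in> H <#> K" for x
  proof -
    from that obtain h k where hk: "h \<in> H" "k \<in> K" "x = h \<otimes> k" by (auto simp: set_mult_def)
    obtain h' where "h' \<in> H" "x [^] (p ^ j) = h' \<otimes> k [^] (p ^ j)" using pow hk by blast
    then have "x [^] (p ^ j) = h'" "h' \<in> H" using j hk by auto
    then have "(x [^] (p ^ j)) [^] (p ^ i) = \<one>" using i by simp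
    then show ?thesis using hk by (simp add: nat_pow_pow power_add)
  qed
  then show ?thesis using sub by (auto simp: p_subgroup_def)
qed

lemma generate_conj_closed:
  assumes "A \<subseteq> carrier G" "x \<in> carrier G" "subgroup H G"
    and "\<And>a. a \<in> A \<Longrightarrow> x \<otimes> a \<otimes> inv x \<in> H" and "h \<in> generate G A"
  shows "x \<otimes> h \<otimes> inv x \<in> H"
  using assms(5)
proof (induction rule: generate.induct)
  case one
  then show ?case using assms by (simp add: subgroup.one_closed)
next
  case (incl h)
  then show ?case using assms by simp
next
  case (inv h)
  have "inv (x \<otimes> h \<otimes> inv x) = x \<otimes> inv h \<otimes> inv x"
    using inv assms(1,2) by (auto simp: inv_mult_group m_assoc subset_iff)
  then show ?case using inv assms(3,4) by (metis subgroup.m_inv_closed)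
next
  case (eng h1 h2)
  have c: "h1 \<in> carrier G" "h2 \<in> carrier G" using eng assms(1) generate_in_carrier by blast+
  have "x \<otimes> (h1 \<otimes> h2) \<otimes> inv x = (x \<otimes> h1 \<otimes> inv x) \<otimes> (x \<otimes> h2 \<otimes> inv x)"
    using c assms(2) by (simp add: m_assoc) (simp add: m_assoc[symmetric])
  then show ?case using eng assms(3) by (simp add: subgroup.m_closed)
qed

text \<open>Companion of \<open>generate_conj_closed\<close> in which the induction runs over the
  conjugating element. Both directions of conjugation are assumed because \<open>generate\<close>
  contains the inverses of generators and H may be infinite.\<close>

lemma generate_conj_closed_generate:
  assumes "B \<subseteq> carrier G" "subgroup H G"
    and H: "\<And>a h. a \<in> B \<Longrightarrow> h \<in> H \<Longrightarrow> a \<otimes> h \<otimes> inv a \<in> H \<and> inv a \<otimes> h \<otimes> a \<in> H"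
    and "x \<in> generate G B" "h \<in> H"
  shows "x \<otimes> h \<otimes> inv x \<in> H"
  using assms(4,5)
proof (induction arbitrary: h rule: generate.induct)
  case one
  then show ?case using assms(2) by (simp add: subgroup.mem_carrier)
next
  case (incl a)
  then show ?case using H by simp
next
  case (inv a)
  then show ?case using H assms(1) by (metis inv_inv subsetD)
next
  case (eng a b)
  have c: "a \<in> carrier G" "b \<in> carrier G" "h \<in> carrier G"
    using eng assms(1,2) generate_in_carrier by (blast, blast, meson subgroup.mem_carrier)
  have "a \<otimes> b \<otimes> h \<otimes> inv (a \<otimes> b) = a \<otimes> (b \<otimes> h \<otimes> inv b) \<otimes> inv a"
    using c by (simp add: m_assoc inv_mult_group)
  then show ?case using eng by simp
qed

end

lemma (in group_action) card_orbit_prime_power: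
  fixes p :: nat
  assumes "prime p" "order G = p ^ n" "x \<in> E"
  shows "\<exists>i. card (orbit G \<phi> x) = p ^ i"
  using orbit_stabilizer_theorem[OF assms(3)] assms(1,2)
  by (metis divides_primepow_nat dvd_triv_left)

text \<open>The moved points are a disjoint union of orbits of length \<open>p ^ i\<close> with i >
  0. An invariant \<open>\<Omega>\<close> is allowed because the set in question is one orbit of a
  larger group, looked at by a smaller one.\<close>

lemma (in group_action) prime_dvd_card_moved_points:
  fixes p :: nat
  assumes p: "prime p" and ord: "order G = p ^ n" and "\<Omega> \<subseteq> E" and fin: "finite \<Omega>"
    and inv: "\<And>g x. g \<in> carrier G \<Longrightarrow> x \<in> \<Omega> \<Longrightarrow> \<phi> g x \<in> \<Omega>"
  shows "p dvd card {x \<in> \<Omega>. \<exists>g\<in>carrier G. \<phi> g x \<noteq> x}"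
proof -
  let ?M = "{x \<in> \<Omega>. \<exists>g\<in>carrier G. \<phi> g x \<noteq> x}"
  interpret group G using group_hom group_hom.axioms(1) by auto
  let ?C = "orbit G \<phi> ` ?M"
  have self: "x \<in> orbit G \<phi> x" if "x \<in> \<Omega>" for x
    using that assms(3) orbit_refl by auto
  have sub: "orbit G \<phi> x \<subseteq> ?M" if x: "x \<in> ?M" for x
  proof
    fix y assume y: "y \<in> orbit G \<phi> x"
    then obtain g where g: "g \<in> carrier G" "y = \<phi> g x" by (auto simp: orbit_def)
    have y\<Omega>: "y \<in> \<Omega>" using g inv x by auto
    have "\<exists>k\<in>carrier G. \<phi> k y \<noteq> y"
    proof (rule ccontr)
      assume fixed: "\<not> ?thesis"
      have "x \<in> orbit G \<phi> y" using y orbit_sym x y\<Omega> assms(3) by (metis (no_types, lifting) mem_Collect_eq subsetD)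
      then have "x = y" using fixed by (auto simp: orbit_def)
      then show False using x fixed by auto
    qed
    then show "y \<in> ?M" using y\<Omega> by auto
  qed
  have U: "\<Union>?C = ?M" using sub self by blast
  have "p dvd card (\<Union>?C)"
  proof (rule dvd_partition)
    show "finite (\<Union>?C)" unfolding U using fin by simp
    show "\<forall>c\<in>?C. p dvd card c"
    proof
      fix c assume "c \<in> ?C"
      then obtain x where x: "x \<in> ?M" "c = orbit G \<phi> x" by blast
      obtain i where i: "card c = p ^ i" using card_orbit_prime_power[OF p ord] x assms(3) by blast
      have "i \<noteq> 0"
      proof
        assume "i = 0"
        then obtain z where "c = {z}" using i card_1_singletonE by (metis power_0)
        then have "orbit G \<phi> x = {x}" using self[of x] x by auto
        then show False using x by (auto simp: orbit_def)
      qed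
      then show "p dvd card c" using i by simp
    qed
    show "\<forall>c1\<in>?C. \<forall>c2\<in>?C. c1 \<noteq> c2 \<longrightarrow> c1 \<inter> c2 = {}"
      using disjoint_union assms(3) by (auto simp: orbits_def)
  qed
  then show ?thesis by (simp only: U)
qed

context group
begin

lemma conj_inv_conj:
  assumes "x \<in> carrier G" "a \<in> carrier G"
  shows "x \<otimes> (inv x \<otimes> a \<otimes> x) \<otimes> inv x = a" "inv x \<otimes> (x \<otimes> a \<otimes> inv x) \<otimes> x = a"
  using assms by (simp_all add: m_assoc) (simp_all add: m_assoc[symmetric])

lemma conj_set_eq_coset: "(\<lambda>a. x \<otimes> a \<otimes> inv x) ` D = x <# D #> inv x"
  by (auto simp: l_coset_def r_coset_def)

text \<open>The $p$-group generated by $D$ fixes $D$ among its conjugates, hence also fixes another one.\<close>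

lemma p_subgroup_normalizer_grows:
  fixes p :: nat
  assumes fin: "finite (carrier G)" and p: "prime p"
    and A: "A \<subseteq> carrier G" "p_subgroup p G (generate G A)"
    and closedA: "\<And>a b. a \<in> A \<Longrightarrow> b \<in> A \<Longrightarrow> a \<otimes> b \<otimes> inv a \<in> A"
    and D: "D \<subset> A"
    and closedD: "\<And>a b. a \<in> D \<Longrightarrow> b \<in> D \<Longrightarrow> a \<otimes> b \<otimes> inv a \<in> D"
  obtains x where "x \<in> A" "x \<notin> D" "\<And>d. d \<in> D \<Longrightarrow> x \<otimes> d \<otimes> inv x \<in> D"
proof -
  define c where "c x X = (\<lambda>a. x \<otimes> a \<otimes> inv x) ` X" for x X
  define \<phi> where "\<phi> = (\<lambda>g. \<lambda>H\<in>{H. H \<subseteq> carrier G}. g <# H #> inv g)"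
  have act: "group_action G {H. H \<subseteq> carrier G} \<phi>"
    unfolding \<phi>_def by (rule action_by_conjugation_on_power_set)
  have \<phi>: "\<phi> g X = c g X" if "X \<subseteq> carrier G" for g X
    using that by (simp add: \<phi>_def c_def conj_set_eq_coset)
  have DG: "D \<subseteq> carrier G" and finD: "finite D" and finA: "finite A"
    using A D fin finite_subset by (blast, meson finite_subset order_trans psubset_imp_subset, blast)
  have c_sub: "c x X \<subseteq> carrier G" if "x \<in> carrier G" "X \<subseteq> carrier G" for x X
    using that by (auto simp: c_def)
  have c_card: "card (c x X) = card X" if "x \<in> carrier G" "X \<subseteq> carrier G" for x X
    unfolding c_def using that by (intro card_image inj_onI) (auto simp: subset_iff)
  have c_inv: "c x (c (inv x) X) = X" "c (inv x) (c x X) = X" if "x \<in> carrier G" "X \<subseteq> carrier G" for x X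
    using that conj_inv_conj by (auto simp: c_def image_image subset_iff)
  have c_eqI: "c x X = X" if "x \<in> carrier G" "X \<subseteq> carrier G" "finite X" "c x X \<subseteq> X" for x X
    using that c_card card_subset_eq by metis
  have c_mult: "c (x \<otimes> y) X = c x (c y X)" if "x \<in> carrier G" "y \<in> carrier G" "X \<subseteq> carrier G" for x y X
    unfolding c_def image_image
  proof (rule image_cong[OF refl])
    fix a assume "a \<in> X"
    then have "a \<in> carrier G" using that by blast
    then show "x \<otimes> y \<otimes> a \<otimes> inv (x \<otimes> y) = x \<otimes> (y \<otimes> a \<otimes> inv y) \<otimes> inv x"
      using that by (simp add: m_assoc inv_mult_group)
  qed
  let ?P = "generate G A" and ?H = "generate G D"
  have P: "subgroup ?P G" and H: "subgroup ?H G"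
    using A(1) DG generate_is_subgroup by auto
  have HP: "?H \<subseteq> ?P" using D mono_generate by blast
  have pH: "p_subgroup p G ?H" using p_subgroup_subset[OF A(2) H HP] .
  interpret actP: group_action "G\<lparr>carrier := ?P\<rparr>" "{H. H \<subseteq> carrier G}" \<phi>
    using group_action.induced_action[OF act P] .
  interpret actH: group_action "G\<lparr>carrier := ?H\<rparr>" "{H. H \<subseteq> carrier G}" \<phi>
    using group_action.induced_action[OF act H] .
  obtain i where i: "order (G\<lparr>carrier := ?P\<rparr>) = p ^ i"
    using card_p_subgroup[OF fin p A(2)] by (auto simp: order_def)
  obtain j where j: "order (G\<lparr>carrier := ?H\<rparr>) = p ^ j"
    using card_p_subgroup[OF fin p pH] by (auto simp: order_def)
  \<comment> \<open>The conjugates of D under \<open>?P\<close>. As a single orbit of a p-group it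
    has p-power size, and the smaller group \<open>?H\<close> acts on it too, with D as a fixed
    point.\<close>
  define \<Omega> where "\<Omega> = orbit (G\<lparr>carrier := ?P\<rparr>) \<phi> D"
  have \<Omega>: "\<Omega> = {c g D | g. g \<in> ?P}" using \<phi> DG by (auto simp: \<Omega>_def orbit_def)
  have PG: "g \<in> carrier G" if "g \<in> ?P" for g using that P subgroup.mem_carrier by metis
  have A_conj: "g \<otimes> a \<otimes> inv g \<in> A" if "g \<in> ?P" "a \<in> A" for g a
  proof -
    have stab: "c x A = A" if "x \<in> A" for x
      using that A(1) closedA finA by (intro c_eqI) (auto simp: c_def)
    have "c (inv x) A = A" if "x \<in> A" for x
      using stab[OF that] c_inv(2)[of x A] that A(1) by auto
    with stab have "x \<in> A \<Longrightarrow> c x A \<subseteq> A" "x \<in> A \<Longrightarrow> c (inv x) A \<subseteq> A" for x by auto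
    then have st: "x \<in> A \<Longrightarrow> b \<in> A \<Longrightarrow> x \<otimes> b \<otimes> inv x \<in> A"
       "x \<in> A \<Longrightarrow> b \<in> A \<Longrightarrow> inv x \<otimes> b \<otimes> inv (inv x) \<in> A" for x b by (auto simp: c_def)
    show ?thesis using that
    proof (induction arbitrary: a rule: generate.induct)
      case one
      then show ?case using A(1) by auto
    next
      case (eng g h)
      have "g \<in> carrier G" "h \<in> carrier G" "a \<in> carrier G" using eng A(1) PG by auto
      then have "g \<otimes> h \<otimes> a \<otimes> inv (g \<otimes> h) = g \<otimes> (h \<otimes> a \<otimes> inv h) \<otimes> inv g"
        by (simp add: m_assoc inv_mult_group)
      then show ?case using eng by simp
    qed (use st in auto)
  qed
  have sub\<Omega>: "X \<subseteq> A" if "X \<in> \<Omega>" for X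
    using that A_conj D by (auto simp: \<Omega> c_def)
  have fin\<Omega>: "finite \<Omega>"
    using sub\<Omega> finA by (meson Pow_iff finite_Pow_iff finite_subset subsetI)
  have D\<Omega>: "D \<in> \<Omega>"
  proof -
    have "c \<one> D = D" using DG by (force simp: c_def)
    then show ?thesis using P unfolding \<Omega> by (force intro: subgroup.one_closed)
  qed
  show ?thesis
  proof (cases "\<Omega> = {D}")
    case True
    obtain x where x: "x \<in> A" "x \<notin> D" using D by blast
    have "c x D \<in> \<Omega>" using x(1) generate.incl[of x A G] unfolding \<Omega> by blast
    then have "c x D = D" using True by simp
    then show ?thesis using that[OF x] by (auto simp: c_def)
  next
    case False
    obtain l where l: "card \<Omega> = p ^ l"
      using actP.card_orbit_prime_power[OF p i, of D] DG unfolding \<Omega>_def by auto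
    have "l \<noteq> 0"
      using False l D\<Omega> by (metis card_1_singletonE power_0 singletonD)
    then have "p dvd card \<Omega>" using l by simp
    define M where "M = {X \<in> \<Omega>. \<exists>g\<in>carrier (G\<lparr>carrier := ?H\<rparr>). \<phi> g X \<noteq> X}"
    have "p dvd card M" unfolding M_def
    proof (rule actH.prime_dvd_card_moved_points[OF p j])
      show "\<Omega> \<subseteq> {H. H \<subseteq> carrier G}" using sub\<Omega> A(1) by blast
      show "finite \<Omega>" by fact
      fix g X assume g: "g \<in> carrier (G\<lparr>carrier := ?H\<rparr>)" and "X \<in> \<Omega>"
      then obtain h where h: "h \<in> ?P" "X = c h D" unfolding \<Omega> by blast
      have gP: "g \<in> ?P" using g HP by auto
      have "\<phi> g X = c (g \<otimes> h) D"
        using \<phi>[OF c_sub[OF PG[OF h(1)] DG]] c_mult[OF PG[OF gP] PG[OF h(1)] DG] h(2) by simp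
      then show "\<phi> g X \<in> \<Omega>" using h(1) gP P unfolding \<Omega> by (auto intro: subgroup.m_closed)
    qed
    have MO: "M \<subseteq> \<Omega>" by (auto simp: M_def)
    have DM: "D \<notin> M"
    proof -
      have "c g D = D" if "g \<in> ?H" for g
      proof (rule c_eqI)
        have D_inv: "inv x \<otimes> d \<otimes> x \<in> D" if "x \<in> D" "d \<in> D" for x d
        proof -
          have xc: "x \<in> carrier G" using that DG by blast
          have "c x D = D" using that closedD finD DG by (intro c_eqI) (auto simp: c_def)
          then have "c (inv x) D = D" using c_inv(2)[OF xc DG] by simp
          then show ?thesis using that xc by (force simp: c_def)
        qed
        show "c g D \<subseteq> D" using that
        proof (induction rule: generate.induct)
          case one
          then show ?case using DG by (auto simp: c_def)
        next
          case (incl h)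
          then show ?case using closedD by (auto simp: c_def)
        next
          case (inv h)
          then have "h \<in> carrier G" using DG by blast
          then show ?case using D_inv inv by (auto simp: c_def)
        next
          case (eng g h)
          then have gh: "g \<in> carrier G" "h \<in> carrier G" using H subgroup.mem_carrier by metis+
          have "c (g \<otimes> h) D = c g (c h D)"
            using gh DG by (rule c_mult)
          moreover have "c g (c h D) \<subseteq> c g D" using eng unfolding c_def by (intro image_mono) auto
          ultimately show ?case using eng by auto
        qed
      qed (use that H DG finD subgroup.mem_carrier in metis)+
      then show ?thesis using \<phi>[OF DG] by (auto simp: M_def)
    qed
    have "card (\<Omega> - M) = card \<Omega> - card M" using fin\<Omega> MO by (meson card_Diff_subset finite_subset)
    then have dvd: "p dvd card (\<Omega> - M)" using \<open>p dvd card \<Omega>\<close> \<open>p dvd card M\<close> by simp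
    have "\<not> \<Omega> - M \<subseteq> {D}"
    proof
      assume "\<Omega> - M \<subseteq> {D}"
      then have "\<Omega> - M = {D}" using D\<Omega> DM by blast
      then show False using dvd p by (simp add: prime_nat_iff)
    qed
    then obtain X where X: "X \<in> \<Omega>" "X \<notin> M" "X \<noteq> D" by blast
    then obtain g where g: "g \<in> ?P" "X = c g D" unfolding \<Omega> by blast
    have gG: "g \<in> carrier G" and XG: "X \<subseteq> carrier G" using g PG sub\<Omega> X A(1) by auto
    \<comment> \<open>D normalises the second fixed point X, the conjugate of D by g. Conjugating
      back by g, the set Y normalises D. It has the size of D and differs from D, so it has an
      element outside D.\<close>
    define Y where "Y = c (inv g) D"
    have "Y \<noteq> D"
      using c_inv(1)[OF gG DG] X(3) g(2) unfolding Y_def by metis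
    moreover have "card Y = card D" unfolding Y_def using c_card gG DG by simp
    ultimately have "\<not> Y \<subseteq> D" using finD card_subset_eq by metis
    then obtain y where y: "y \<in> Y" "y \<notin> D" by blast
    have "Y \<in> \<Omega>" unfolding \<Omega> Y_def using g P by (auto intro: subgroup.m_inv_closed)
    then have yA: "y \<in> A" using y sub\<Omega> by blast
    obtain d where d: "d \<in> D" "y = inv g \<otimes> d \<otimes> g"
      using y(1) gG unfolding Y_def c_def by auto
    have dG: "d \<in> carrier G" using d DG by blast
    have dX: "c d X = X" using X \<phi>[OF XG] generate.incl[OF d(1), of G] by (auto simp: M_def)
    have "c y D = c (inv g) (c d (c g D))"
      using gG dG DG unfolding d(2) by (simp add: c_mult c_sub m_assoc)
    also have "\<dots> = D" using dX g(2) c_inv(2)[OF gG DG] by simp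
    finally have "c y D = D" .
    then show ?thesis using that[OF yA y(2)] by (auto simp: c_def)
  qed
qed


lemma p_subgroup_generate_Un:
  assumes X: "X \<subseteq> carrier G" "p_subgroup p G (generate G X)"
    and Y: "Y \<subseteq> carrier G" "p_subgroup p G (generate G Y)"
    and norm: "\<And>x y. x \<in> X \<Longrightarrow> y \<in> Y \<Longrightarrow> y \<otimes> x \<otimes> inv y \<in> generate G X"
       "\<And>x y. x \<in> X \<Longrightarrow> y \<in> Y \<Longrightarrow> inv y \<otimes> x \<otimes> y \<in> generate G X"
  shows "p_subgroup p G (generate G (X \<union> Y))"
proof -
  have GX: "subgroup (generate G X) G" and GY: "subgroup (generate G Y) G"
    using X Y generate_is_subgroup by auto
  have *: "p_subgroup p G (generate G X <#> generate G Y)"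
  proof (rule p_subgroup_mult[OF X(2) Y(2)])
    fix h k assume h: "h \<in> generate G X" and k: "k \<in> generate G Y"
    have norm': "a \<otimes> h \<otimes> inv a \<in> generate G X \<and> inv a \<otimes> h \<otimes> a \<in> generate G X"
      if a: "a \<in> Y" and h: "h \<in> generate G X" for a h
    proof -
      have aG: "a \<in> carrier G" using a Y by blast
      show ?thesis
        using generate_conj_closed[OF X(1) aG GX norm(1)[OF _ a] h]
          generate_conj_closed[OF X(1) inv_closed[OF aG] GX _ h] norm(2)[OF _ a] aG by simp
    qed
    show "k \<otimes> h \<otimes> inv k \<in> generate G X"
      by (rule generate_conj_closed_generate[OF Y(1) GX norm' k h])
  qed
  have "X \<union> Y \<subseteq> generate G X <#> generate G Y"
  proof
    fix z assume z: "z \<in> X \<union> Y"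
    have zG: "z \<in> carrier G" using z X(1) Y(1) by blast
    have "\<one> \<in> generate G X" "\<one> \<in> generate G Y" by (rule generate.one)+
    moreover have "z \<in> generate G X \<or> z \<in> generate G Y" using z by (auto intro: generate.incl)
    moreover have "z \<otimes> \<one> = z" "\<one> \<otimes> z = z" using zG by simp_all
    ultimately show "z \<in> generate G X <#> generate G Y"
      unfolding set_mult_def by force
  qed
  then have "generate G (X \<union> Y) \<subseteq> generate G X <#> generate G Y"
    using * by (intro generate_subgroup_incl) (auto simp: p_subgroup_def)
  moreover have "X \<union> Y \<subseteq> carrier G" using X(1) Y(1) by simp
  ultimately show ?thesis
    using p_subgroup_subset[OF * generate_is_subgroup] by simp
qed

text \<open>Among the maximal subsets of C that generate p-groups, take two different ones, A and B,
  with largest intersection D. Each has an element outside D that normalises D. These two generate a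
  p-group by \<open>pairs\<close>, and it normalises the group generated by D, so D and both
  elements lie in one maximal set E. As E meets A and B in more than D, it equals both.\<close>

theorem baer_suzuki:
  fixes p :: nat
  assumes fin: "finite (carrier G)" and p: "prime p" and C: "C \<subseteq> carrier G"
    and closed: "\<And>a b. a \<in> C \<Longrightarrow> b \<in> C \<Longrightarrow> a \<otimes> b \<otimes> inv a \<in> C"
    and pairs: "\<And>a b. a \<in> C \<Longrightarrow> b \<in> C \<Longrightarrow> p_subgroup p G (generate G {a, b})"
  shows "p_subgroup p G (generate G C)"
proof (rule ccontr)
  assume bad: "\<not> p_subgroup p G (generate G C)"
  define good where "good A \<longleftrightarrow> A \<subseteq> C \<and> p_subgroup p G (generate G A)" for A
  define maxl where "maxl A \<longleftrightarrow> good A \<and> (\<forall>B. good B \<longrightarrow> A \<subseteq> B \<longrightarrow> B = A)" for A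
  have finC: "finite C" using C fin finite_subset by blast
  have finG: "finite {A. good A}"
    by (rule finite_subset[of _ "Pow C"]) (use finC in \<open>auto simp: good_def\<close>)
  have ext: "\<exists>B. maxl B \<and> A \<subseteq> B" if "good A" for A
    using finite_has_maximal2[OF finG, of A] that by (auto simp: maxl_def)
  have good1: "good {x}" if "x \<in> C" for x
    using pairs[OF that that] that by (auto simp: good_def)
  \<comment> \<open>A maximal set already contains all elements of C in the group it generates; this
    is what makes it closed under conjugation by its own elements.\<close>
  have maxl_C: "C \<inter> generate G A = A" if "maxl A" for A
  proof -
    let ?B = "C \<inter> generate G A"
    have A: "good A" and AC: "A \<subseteq> C" using that by (auto simp: maxl_def good_def)
    have "generate G ?B \<subseteq> generate G A"
      using A C AC generate_is_subgroup by (intro generate_subgroup_incl) auto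
    then have "p_subgroup p G (generate G ?B)"
      using A C by (auto simp: good_def intro: p_subgroup_subset[OF _ generate_is_subgroup])
    then have "good ?B" by (simp add: good_def)
    moreover have "A \<subseteq> ?B" using AC by (auto intro: generate.incl)
    ultimately show ?thesis using that by (simp add: maxl_def)
  qed
  have maxl_closed: "a \<otimes> b \<otimes> inv a \<in> A" if "maxl A" "a \<in> A" "b \<in> A" for A a b
  proof -
    have "A \<subseteq> C" using that by (auto simp: maxl_def good_def)
    then have "a \<otimes> b \<otimes> inv a \<in> C" using closed that by blast
    moreover have "a \<otimes> b \<otimes> inv a \<in> generate G A"
      using that by (intro generate.eng generate.inv generate.incl)
    ultimately show ?thesis using maxl_C[OF that(1)] by blast
  qed
  define S where "S = {(A, B). maxl A \<and> maxl B \<and> A \<noteq> B}"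
  have finS: "finite S"
    by (rule finite_subset[of _ "{A. good A} \<times> {A. good A}"]) (use finG in \<open>auto simp: S_def maxl_def\<close>)
  \<comment> \<open>A maximal set above one point of C is not all of C, and a maximal set above a
    point that it misses is a second one.\<close>
  have "S \<noteq> {}"
  proof -
    have "C \<noteq> {}"
      using bad generate_is_subgroup[of "{}"] by (auto simp: p_subgroup_def generate_empty)
    then obtain x where x: "x \<in> C" by blast
    obtain A where A: "maxl A" using ext[OF good1[OF x]] by blast
    have "A \<noteq> C" using bad A by (auto simp: maxl_def good_def)
    moreover have "A \<subseteq> C" using A by (auto simp: maxl_def good_def)
    ultimately obtain y where y: "y \<in> C" "y \<notin> A" by blast
    obtain B where "maxl B" "y \<in> B" using ext[OF good1[OF y(1)]] by blast
    then show ?thesis using A y by (auto simp: S_def)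
  qed
  then obtain A B where AB: "maxl A" "maxl B" "A \<noteq> B"
    and mx: "\<And>A' B'. maxl A' \<Longrightarrow> maxl B' \<Longrightarrow> A' \<noteq> B' \<Longrightarrow> card (A' \<inter> B') \<le> card (A \<inter> B)"
  proof -
    let ?f = "\<lambda>s. card (fst s \<inter> snd s)"
    have "Max (?f ` S) \<in> ?f ` S" using finS \<open>S \<noteq> {}\<close> by (intro Max_in) auto
    then obtain s where s: "s \<in> S" "Max (?f ` S) = ?f s" by blast
    have le: "?f t \<le> ?f s" if "t \<in> S" for t
      unfolding s(2)[symmetric] using that finS by (intro Max_ge) auto
    show ?thesis
    proof (rule that[of "fst s" "snd s"])
      show "card (A' \<inter> B') \<le> card (fst s \<inter> snd s)" if "maxl A'" "maxl B'" "A' \<noteq> B'" for A' B'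
        using le[of "(A', B')"] that by (simp add: S_def)
    qed (use s(1) in \<open>auto simp: S_def\<close>)
  qed
  define D where "D = A \<inter> B"
  have closedD: "a \<otimes> b \<otimes> inv a \<in> D" if "a \<in> D" "b \<in> D" for a b
    using that maxl_closed[OF AB(1), of a b] maxl_closed[OF AB(2), of a b] by (simp add: D_def)
  have grow: "\<exists>x. x \<in> E \<and> x \<notin> D \<and> (\<forall>d\<in>D. x \<otimes> d \<otimes> inv x \<in> D)" if E: "maxl E" "D \<subset> E" for E
  proof (rule p_subgroup_normalizer_grows[OF fin p, of E D])
    show "E \<subseteq> carrier G" "p_subgroup p G (generate G E)" using E(1) C by (auto simp: maxl_def good_def)
    show "a \<otimes> b \<otimes> inv a \<in> E" if "a \<in> E" "b \<in> E" for a b using maxl_closed[OF E(1) that] .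
    show "a \<otimes> b \<otimes> inv a \<in> D" if "a \<in> D" "b \<in> D" for a b using closedD[OF that] .
  qed (use E in blast)+
  have DA: "D \<subset> A" and DB: "D \<subset> B" using AB by (auto simp: D_def maxl_def)
  obtain x where x: "x \<in> A" "x \<notin> D" "\<And>d. d \<in> D \<Longrightarrow> x \<otimes> d \<otimes> inv x \<in> D" using grow[OF AB(1) DA] by blast
  obtain y where y: "y \<in> B" "y \<notin> D" "\<And>d. d \<in> D \<Longrightarrow> y \<otimes> d \<otimes> inv y \<in> D" using grow[OF AB(2) DB] by blast
  have AC: "A \<subseteq> C" "B \<subseteq> C" "p_subgroup p G (generate G A)" using AB by (auto simp: maxl_def good_def)
  have DG: "D \<subseteq> carrier G" using AC C by (auto simp: D_def)
  have finD: "finite D" using DG fin finite_subset by blast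
  have inv_norm: "inv z \<otimes> d \<otimes> z \<in> D" if z: "z \<in> carrier G" "\<And>d. d \<in> D \<Longrightarrow> z \<otimes> d \<otimes> inv z \<in> D" and "d \<in> D" for z d
  proof -
    have "inj_on (\<lambda>d. z \<otimes> d \<otimes> inv z) D" using z(1) DG by (auto intro!: inj_onI simp: subset_iff)
    then have "(\<lambda>d. z \<otimes> d \<otimes> inv z) ` D = D" using finD z(2) by (intro endo_inj_surj) auto
    then obtain d' where "d' \<in> D" "d = z \<otimes> d' \<otimes> inv z" using \<open>d \<in> D\<close> by blast
    then show ?thesis using conj_inv_conj(2)[of z d'] z(1) DG by auto
  qed
  have xy: "x \<in> C" "y \<in> C" using x y AC by auto
  have "p_subgroup p G (generate G (D \<union> {x, y}))"
  proof (rule p_subgroup_generate_Un)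
    show "p_subgroup p G (generate G D)"
      using AC(3) DG by (rule p_subgroup_subset[OF _ generate_is_subgroup]) (auto simp: D_def intro!: mono_generate)
    show "p_subgroup p G (generate G {x, y})" using pairs xy by blast
    show "b \<otimes> a \<otimes> inv b \<in> generate G D" if "a \<in> D" "b \<in> {x, y}" for a b
      using that x(3)[of a] y(3)[of a] by (elim insertE) (simp_all add: generate.incl)
    show "inv b \<otimes> a \<otimes> b \<in> generate G D" if "a \<in> D" "b \<in> {x, y}" for a b
    proof (rule generate.incl, rule inv_norm[OF _ _ that(1)])
      show "b \<otimes> d \<otimes> inv b \<in> D" if "d \<in> D" for d
        using \<open>b \<in> {x, y}\<close> x(3)[OF that] y(3)[OF that] by (elim insertE) simp_all
    qed (use that xy C in auto)
  qed (use DG xy C in auto)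
  then have "good (D \<union> {x, y})" using xy AC by (auto simp: good_def D_def)
  then obtain E where E: "maxl E" "D \<union> {x, y} \<subseteq> E" using ext by blast
  have finE: "finite E" using E finC finite_subset by (auto simp: maxl_def good_def)
  have "card D < card (E \<inter> A)"
    by (rule psubset_card_mono) (use finE E x DA in auto)
  then have "E = A" using mx[OF E(1) AB(1)] unfolding D_def by linarith
  have "card D < card (E \<inter> B)"
    by (rule psubset_card_mono) (use finE E y DB in auto)
  then have "E = B" using mx[OF E(1) AB(2)] unfolding D_def by linarith
  then show False using \<open>E = A\<close> AB by simp
qed


section \<open>Building 3-groups from commutator relations\<close>

lemma p_subgroup_generate_singleton:
  assumes "x \<in> carrier G" "x [^] p = \<one>"
  shows "p_subgroup p G (generate G {x})"
proof -
  have "y [^] (p ^ 1) = \<one>" if y: "y \<in> generate G {x}" for y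
  proof -
    obtain k :: int where "y = x [^] k" using y generate_pow[OF assms(1)] by auto
    then have "y [^] int p = (x [^] int p) [^] k" using assms(1) by (simp add: int_pow_pow mult.commute)
    then show ?thesis using assms by (simp add: int_pow_int)
  qed
  moreover have "subgroup (generate G {x}) G" using generate_is_subgroup assms(1) by auto
  ultimately show ?thesis unfolding p_subgroup_def by blast
qed

lemma conj_eqI:
  assumes "y \<otimes> x = r \<otimes> x \<otimes> y" "x \<in> carrier G" "y \<in> carrier G" "r \<in> carrier G"
  shows "y \<otimes> x \<otimes> inv y = r \<otimes> x"
  using assms by (simp add: m_assoc)

text \<open>Here r is the commutator of y and x, so conjugation by y maps the finite group generated
  by X into itself, hence onto itself; this yields the inverse conjugation that
  \<open>p_subgroup_generate_Un\<close> asks for. Each use puts one more generator on top of a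
  normal series.\<close>

lemma p_subgroup_generate_insert:
  assumes fin: "finite (carrier G)" and X: "X \<subseteq> carrier G" "p_subgroup p G (generate G X)"
    and y: "y \<in> carrier G" "y [^] p = \<one>"
    and norm: "\<And>x. x \<in> X \<Longrightarrow> \<exists>r\<in>generate G X. y \<otimes> x = r \<otimes> x \<otimes> y"
  shows "p_subgroup p G (generate G (insert y X))"
proof -
  let ?H = "generate G X"
  have H: "subgroup ?H G" using X(1) generate_is_subgroup by auto
  have HG: "?H \<subseteq> carrier G" using H subgroup.subset by auto
  have conj: "y \<otimes> x \<otimes> inv y \<in> ?H" if x: "x \<in> X" for x
  proof -
    obtain r where r: "r \<in> ?H" "y \<otimes> x = r \<otimes> x \<otimes> y" using norm[OF x] by blast
    then have "y \<otimes> x \<otimes> inv y = r \<otimes> x" using x y HG X(1) by (intro conj_eqI) auto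
    then show ?thesis using r(1) x generate.eng generate.incl by metis
  qed
  have all: "y \<otimes> h \<otimes> inv y \<in> ?H" if "h \<in> ?H" for h
    using generate_conj_closed[OF X(1) y(1) H conj that] .
  have "inj_on (\<lambda>h. y \<otimes> h \<otimes> inv y) ?H" using y(1) HG by (auto intro!: inj_onI simp: subset_iff)
  moreover have "finite ?H" using HG fin finite_subset by blast
  moreover have "(\<lambda>h. y \<otimes> h \<otimes> inv y) ` ?H \<subseteq> ?H" using all by blast
  ultimately have surj: "(\<lambda>h. y \<otimes> h \<otimes> inv y) ` ?H = ?H" by (intro endo_inj_surj) auto
  have conj': "inv y \<otimes> x \<otimes> y \<in> ?H" if x: "x \<in> X" for x
  proof -
    have "x \<in> ?H" using x generate.incl by metis
    then obtain h where h: "h \<in> ?H" "x = y \<otimes> h \<otimes> inv y" using surj by blast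
    then have "inv y \<otimes> x \<otimes> y = h" using conj_inv_conj(2)[of y h] y(1) HG by auto
    then show ?thesis using h by simp
  qed
  have "p_subgroup p G (generate G (X \<union> {y}))"
    by (rule p_subgroup_generate_Un[OF X _ p_subgroup_generate_singleton[OF y]])
      (use y conj conj' in auto)
  then show ?thesis by simp
qed

lemma cube_eq: "x \<in> carrier G \<Longrightarrow> x [^] (3::nat) = x \<otimes> x \<otimes> x"
  by (simp add: numeral_3_eq_3)

text \<open>The conjugate \<open>z x\<close> of x again has cube 1, and since z commutes with x the
  cube of z splits off.\<close>

lemma central_commutator_cube:
  assumes c: "x \<in> carrier G" "y \<in> carrier G" "z \<in> carrier G"
    and eq: "y \<otimes> x = z \<otimes> x \<otimes> y" and comm: "z \<otimes> x = x \<otimes> z" and x3: "x [^] (3::nat) = \<one>"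
  shows "z [^] (3::nat) = \<one>"
proof -
  have conj: "y \<otimes> x \<otimes> inv y = z \<otimes> x" using conj_eqI[OF eq] c by blast
  have "(y \<otimes> x \<otimes> inv y) [^] (3::nat) = y \<otimes> x [^] (3::nat) \<otimes> inv y"
    using c by (simp add: cube_eq m_assoc) (simp add: m_assoc[symmetric])
  then have "(z \<otimes> x) [^] (3::nat) = \<one>" using conj x3 c by simp
  moreover have "(z \<otimes> x) [^] (3::nat) = z [^] (3::nat) \<otimes> x [^] (3::nat)"
    using pow_mult_distrib[OF comm c(3) c(1)] by simp
  ultimately show ?thesis using x3 c by simp
qed

text \<open>Collecting \<open>x y x y x y\<close> moves an x past a y three times in all, once for
  the second x and twice for the third. Each move costs one factor z, and \<open>z^3\<close> is
  trivial.\<close>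

lemma cube_mult_eq_one:
  assumes c: "x \<in> carrier G" "y \<in> carrier G" "z \<in> carrier G"
    and eq: "y \<otimes> x = z \<otimes> x \<otimes> y" and comm: "z \<otimes> x = x \<otimes> z" "z \<otimes> y = y \<otimes> z"
    and 3: "x [^] (3::nat) = \<one>" "y [^] (3::nat) = \<one>"
  shows "(x \<otimes> y) [^] (3::nat) = \<one>"
proof -
  have z3: "z [^] (3::nat) = \<one>" using central_commutator_cube[OF c eq comm(1) 3(1)] .
  have e1: "y \<otimes> (x \<otimes> w) = z \<otimes> (x \<otimes> (y \<otimes> w))" if "w \<in> carrier G" for w
    using that c arg_cong[OF eq, of "\<lambda>u. u \<otimes> w"] by (simp add: m_assoc)
  have e2: "x \<otimes> (z \<otimes> w) = z \<otimes> (x \<otimes> w)" "y \<otimes> (z \<otimes> w) = z \<otimes> (y \<otimes> w)" if "w \<in> carrier G" for w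
    using that c arg_cong[OF comm(1), of "\<lambda>u. u \<otimes> w"] arg_cong[OF comm(2), of "\<lambda>u. u \<otimes> w"]
    by (simp_all add: m_assoc)
  have "(x \<otimes> y) [^] (3::nat) = z [^] (3::nat) \<otimes> (x [^] (3::nat) \<otimes> y [^] (3::nat))"
    using c by (simp add: cube_eq m_assoc e1 e2)
  then show ?thesis using z3 3 by simp
qed

text \<open>The central series of the group generated by $A$, $B$, $C$: the element $Q$ generates, modulo
  the centre, the third term, and $F$, $H$, $K$ are the commutators of the generators.\<close>

lemma three_generated_3_group:
  assumes fin: "finite (carrier G)"
    and c: "A \<in> carrier G" "B \<in> carrier G" "C \<in> carrier G" "Q \<in> carrier G"
      "F \<in> carrier G" "H \<in> carrier G" "K \<in> carrier G"
    and cube: "\<And>x. x \<in> {A, B, C, Q, F, H, K} \<Longrightarrow> x [^] (3::nat) = \<one>"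
    and FHK: "A \<otimes> B = F \<otimes> B \<otimes> A" "B \<otimes> C = H \<otimes> C \<otimes> B" "C \<otimes> A = K \<otimes> A \<otimes> C"
    and comm: "F \<otimes> A = A \<otimes> F" "F \<otimes> B = B \<otimes> F" "F \<otimes> Q = Q \<otimes> F"
      "H \<otimes> B = B \<otimes> H" "H \<otimes> C = C \<otimes> H" "H \<otimes> Q = Q \<otimes> H"
      "K \<otimes> C = C \<otimes> K" "K \<otimes> A = A \<otimes> K" "K \<otimes> Q = Q \<otimes> K"
    and Z: "\<And>z. z \<in> Z \<Longrightarrow> z \<in> carrier G" "\<And>z w. z \<in> Z \<Longrightarrow> w \<in> Z \<Longrightarrow> z \<otimes> w \<in> Z"
      "\<And>z. z \<in> Z \<Longrightarrow> inv z \<in> Z" "\<one> \<in> Z"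
      "\<And>z x. z \<in> Z \<Longrightarrow> x \<in> Z \<union> {A, B, C, Q, F, H, K} \<Longrightarrow> z \<otimes> x = x \<otimes> z"
    and central: "zA \<in> Z" "Q \<otimes> A = zA \<otimes> A \<otimes> Q" "zB \<in> Z" "Q \<otimes> B = zB \<otimes> B \<otimes> Q"
      "zC \<in> Z" "Q \<otimes> C = zC \<otimes> C \<otimes> Q"
      "zFH \<in> Z" "H \<otimes> F = zFH \<otimes> F \<otimes> H" "zFK \<in> Z" "K \<otimes> F = zFK \<otimes> F \<otimes> K"
      "zHK \<in> Z" "K \<otimes> H = zHK \<otimes> H \<otimes> K"
    and third: "kF \<in> Z" "F \<otimes> C = kF \<otimes> Q \<otimes> C \<otimes> F" "kH \<in> Z" "H \<otimes> A = kH \<otimes> Q \<otimes> A \<otimes> H"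
      "kK \<in> Z" "K \<otimes> B = kK \<otimes> Q \<otimes> B \<otimes> K"
  shows "p_subgroup 3 G (generate G {A, B, C})"
proof -
  \<comment> \<open>Nothing bounds the exponent of Z, so the series starts from the part of Z killed
    by cubing. \<open>in_Y\<close> and \<open>k_in_Y\<close> show that all central factors of the
    relations lie in it.\<close>
  define Y where "Y = {z \<in> Z. z [^] (3::nat) = \<one>}"
  have YZ: "z \<in> Z" if "z \<in> Y" for z using that by (simp add: Y_def)
  have Yc: "z \<in> carrier G" if "z \<in> Y" for z using that Z(1) YZ by blast
  have comm_ex: "\<exists>r\<in>generate G X. y \<otimes> x = r \<otimes> x \<otimes> y"
    if "y \<otimes> x = x \<otimes> y" "x \<in> carrier G" "y \<in> carrier G" for x y X
    using that by (intro bexI[of _ \<one>] generate.one) simp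
  have Ycomm: "\<exists>r\<in>generate G X. x \<otimes> z = r \<otimes> z \<otimes> x" if "z \<in> Y" "x \<in> {A, B, C, Q, F, H, K}" for z x X
  proof (rule comm_ex)
    show "x \<otimes> z = z \<otimes> x" by (rule Z(5)[symmetric]) (use that YZ in auto)
  qed (use that Yc c in auto)
  have subY: "subgroup Y G"
  proof (rule subgroupI)
    show "Y \<subseteq> carrier G" using Yc by blast
    show "Y \<noteq> {}" using Z(4) by (auto simp: Y_def)
    show "inv z \<in> Y" if "z \<in> Y" for z
      using that Z(1,3) by (auto simp: Y_def nat_pow_inv)
    show "z \<otimes> w \<in> Y" if "z \<in> Y" "w \<in> Y" for z w
      using that Z(1,2) Z(5)[of z w] pow_mult_distrib[of z w "3::nat"] by (auto simp: Y_def)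
  qed
  have pY: "p_subgroup 3 G Y" using subY by (auto simp: p_subgroup_def Y_def intro: exI[of _ 1])
  have genY: "generate G Y = Y"
    using generate_subgroup_incl[OF _ subY, of Y] by (auto intro: generate.incl)
  have in_Y: "z \<in> Y" if "z \<in> Z" "x \<in> {A, B, C, Q, F, H, K}" "y \<in> carrier G" "y \<otimes> x = z \<otimes> x \<otimes> y" for x y z
    using central_commutator_cube[of x y z] that cube[OF that(2)] Z(1)[of z] Z(5)[of z x] c
    unfolding Y_def by auto
  have zs: "zA \<in> Y" "zB \<in> Y" "zC \<in> Y" "zFH \<in> Y" "zFK \<in> Y" "zHK \<in> Y"
    using in_Y[OF central(1) _ _ central(2)] in_Y[OF central(3) _ _ central(4)] in_Y[OF central(5) _ _ central(6)]
      in_Y[OF central(7) _ _ central(8)] in_Y[OF central(9) _ _ central(10)] in_Y[OF central(11) _ _ central(12)] c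
    by auto
  \<comment> \<open>The conjugate \<open>k Q x\<close> of x has cube 1. So has \<open>Q x\<close>,
    because Q and x commute up to the central z, and k commutes with \<open>Q x\<close>; hence the
    cube of k is 1.\<close>
  have k_in_Y: "k \<in> Y" if k: "k \<in> Z" "F' \<otimes> x = k \<otimes> Q \<otimes> x \<otimes> F'" "x \<in> {A, B, C}" "F' \<in> {F, H, K}"
     "z \<in> Z" "Q \<otimes> x = z \<otimes> x \<otimes> Q" for k x z F'
  proof -
    have xc: "x \<in> carrier G" "F' \<in> carrier G" "k \<in> carrier G" "z \<in> carrier G" using k c Z(1) by auto
    have x3: "x [^] (3::nat) = \<one>" "Q [^] (3::nat) = \<one>" using cube k by auto
    have zx: "z \<otimes> x = x \<otimes> z" "z \<otimes> Q = Q \<otimes> z" "k \<otimes> x = x \<otimes> k" "k \<otimes> Q = Q \<otimes> k"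
      by (intro Z(5); use k in auto)+
    have xQ3: "(x \<otimes> Q) [^] (3::nat) = \<one>"
      using cube_mult_eq_one[OF xc(1) c(4) xc(4) k(6) zx(1,2) x3] .
    have "z [^] (3::nat) = \<one>" using in_Y[OF k(5) _ c(4) k(6)] k(3) by (auto simp: Y_def)
    moreover have "Q \<otimes> x = z \<otimes> (x \<otimes> Q)" using k(6) xc c by (simp add: m_assoc)
    moreover have "z \<otimes> (x \<otimes> Q) = (x \<otimes> Q) \<otimes> z"
      using zx(1,2) xc c by (metis m_assoc)
    ultimately have Qx3: "(Q \<otimes> x) [^] (3::nat) = \<one>"
      using pow_mult_distrib[of z "x \<otimes> Q" "3::nat"] xQ3 xc c by auto
    have comm_kQx: "k \<otimes> (Q \<otimes> x) = (Q \<otimes> x) \<otimes> k"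
      using zx(3,4) xc c by (metis m_assoc)
    have "F' \<otimes> x \<otimes> inv F' = k \<otimes> Q \<otimes> x"
      using k(2) xc c by (simp add: m_assoc)
    moreover have "(F' \<otimes> x \<otimes> inv F') [^] (3::nat) = F' \<otimes> x [^] (3::nat) \<otimes> inv F'"
      using xc by (simp add: cube_eq m_assoc) (simp add: m_assoc[symmetric])
    ultimately have "(k \<otimes> (Q \<otimes> x)) [^] (3::nat) = \<one>" using x3 xc c by (simp add: m_assoc)
    then have "k [^] (3::nat) = \<one>"
      using pow_mult_distrib[OF comm_kQx, of "3::nat"] Qx3 xc c by simp
    then show ?thesis using k(1) by (simp add: Y_def)
  qed
  have ks: "kF \<in> Y" "kH \<in> Y" "kK \<in> Y"
    using k_in_Y[OF third(1,2) _ _ central(5,6)] k_in_Y[OF third(3,4) _ _ central(1,2)]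
      k_in_Y[OF third(5,6) _ _ central(3,4)] by auto
  let ?g = "generate G"
  have gY: "z \<in> ?g X" if "z \<in> Y" "Y \<subseteq> X" for z X using that by (auto intro: generate.incl)
  have gQ: "inv Q \<otimes> inv k \<in> ?g X" if "k \<in> Y" "Y \<subseteq> X" "Q \<in> X" for k X
    using that by (auto intro!: generate.eng generate.inv)
  have flip: "y \<otimes> x = inv z \<otimes> x \<otimes> y" if "x \<otimes> y = z \<otimes> y \<otimes> x" "x \<in> carrier G" "y \<in> carrier G" "z \<in> carrier G" for x y z
    using that by (simp add: m_assoc) (simp add: m_assoc[symmetric])
  have third': "x \<otimes> F' = (inv Q \<otimes> inv k) \<otimes> F' \<otimes> x"
    if "F' \<otimes> x = k \<otimes> Q \<otimes> x \<otimes> F'" "x \<in> carrier G" "F' \<in> carrier G" "k \<in> carrier G" for x k F'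
  proof -
    have "x \<otimes> F' = inv (k \<otimes> Q) \<otimes> F' \<otimes> x" using that c by (intro flip) auto
    then show ?thesis using that c by (simp add: inv_mult_group)
  qed
  \<comment> \<open>The generators join Y in the order Q, F, H, K, A, B, C, so that the commutator
    of a new generator with an earlier one always lies in the group already built.\<close>
  have p1: "p_subgroup 3 G (?g (insert Q Y))"
  proof (rule p_subgroup_generate_insert[OF fin])
    show "\<exists>r\<in>?g Y. Q \<otimes> x = r \<otimes> x \<otimes> Q" if "x \<in> Y" for x
      using Ycomm[OF that, of Q] by simp
  qed (use Yc pY genY c(4) cube[of Q] in auto)
  have p2: "p_subgroup 3 G (?g (insert F (insert Q Y)))" (is "p_subgroup 3 G (?g (insert F ?X))")
  proof (rule p_subgroup_generate_insert[OF fin _ p1])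
    fix x assume "x \<in> ?X"
    then consider "x = Q" | "x \<in> Y" by blast
    then show "\<exists>r\<in>?g ?X. F \<otimes> x = r \<otimes> x \<otimes> F"
    proof cases
      case 1
      then show ?thesis using comm_ex[OF comm(3)] c by simp
    next
      case 2
      then show ?thesis using Ycomm[of x F] by simp
    qed
  qed (use Yc c cube in force)+
  have p3: "p_subgroup 3 G (?g (insert H (insert F (insert Q Y))))" (is "p_subgroup 3 G (?g (insert H ?X))")
  proof (rule p_subgroup_generate_insert[OF fin _ p2])
    fix x assume "x \<in> ?X"
    then consider "x = F" | "x = Q" | "x \<in> Y" by blast
    then show "\<exists>r\<in>?g ?X. H \<otimes> x = r \<otimes> x \<otimes> H"
    proof cases
      case 1
      then show ?thesis using central(8) gY[OF zs(4), of ?X] by blast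
    next
      case 2
      then show ?thesis using comm_ex[OF comm(6)] c by simp
    next
      case 3
      then show ?thesis using Ycomm[of x H] by simp
    qed
  qed (use Yc c cube in force)+
  have p4: "p_subgroup 3 G (?g (insert K (insert H (insert F (insert Q Y)))))" (is "p_subgroup 3 G (?g (insert K ?X))")
  proof (rule p_subgroup_generate_insert[OF fin _ p3])
    fix x assume "x \<in> ?X"
    then consider "x = H" | "x = F" | "x = Q" | "x \<in> Y" by blast
    then show "\<exists>r\<in>?g ?X. K \<otimes> x = r \<otimes> x \<otimes> K"
    proof cases
      case 1
      then show ?thesis using central(12) gY[OF zs(6), of ?X] by blast
    next
      case 2
      then show ?thesis using central(10) gY[OF zs(5), of ?X] by blast
    next
      case 3
      then show ?thesis using comm_ex[OF comm(9)] c by simp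
    next
      case 4
      then show ?thesis using Ycomm[of x K] by simp
    qed
  qed (use Yc c cube in force)+
  have zs': "inv zA \<in> Y" "inv zB \<in> Y" "inv zC \<in> Y" using zs subY by (auto intro: subgroup.m_inv_closed)
  have p5: "p_subgroup 3 G (?g (insert A (insert K (insert H (insert F (insert Q Y))))))" (is "p_subgroup 3 G (?g (insert A ?X))")
  proof (rule p_subgroup_generate_insert[OF fin _ p4])
    fix x assume "x \<in> ?X"
    then consider "x = K" | "x = H" | "x = F" | "x = Q" | "x \<in> Y" by blast
    then show "\<exists>r\<in>?g ?X. A \<otimes> x = r \<otimes> x \<otimes> A"
    proof cases
      case 1
      then show ?thesis using comm_ex[OF comm(8)[symmetric]] c by simp
    next
      case 2
      then show ?thesis using third'[OF third(4)] gQ[OF ks(2), of ?X] c Yc[OF ks(2)] by blast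
    next
      case 3
      then show ?thesis using comm_ex[OF comm(1)[symmetric]] c by simp
    next
      case 4
      then show ?thesis using flip[OF central(2)] gY[OF zs'(1), of ?X] c Yc[OF zs(1)] by blast
    next
      case 5
      then show ?thesis using Ycomm[of x A] by simp
    qed
  qed (use Yc c cube in force)+
  have p6: "p_subgroup 3 G (?g (insert B (insert A (insert K (insert H (insert F (insert Q Y)))))))" (is "p_subgroup 3 G (?g (insert B ?X))")
  proof (rule p_subgroup_generate_insert[OF fin _ p5])
    fix x assume "x \<in> ?X"
    then consider "x = A" | "x = K" | "x = H" | "x = F" | "x = Q" | "x \<in> Y" by blast
    then show "\<exists>r\<in>?g ?X. B \<otimes> x = r \<otimes> x \<otimes> B"
    proof cases
      case 1
      then show ?thesis using flip[OF FHK(1)] c by (auto intro!: bexI[of _ "inv F"] generate.inv)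
    next
      case 2
      then show ?thesis using third'[OF third(6)] gQ[OF ks(3), of ?X] c Yc[OF ks(3)] by blast
    next
      case 3
      then show ?thesis using comm_ex[OF comm(4)[symmetric]] c by simp
    next
      case 4
      then show ?thesis using comm_ex[OF comm(2)[symmetric]] c by simp
    next
      case 5
      then show ?thesis using flip[OF central(4)] gY[OF zs'(2), of ?X] c Yc[OF zs(2)] by blast
    next
      case 6
      then show ?thesis using Ycomm[of x B] by simp
    qed
  qed (use Yc c cube in force)+
  have p7: "p_subgroup 3 G (?g (insert C (insert B (insert A (insert K (insert H (insert F (insert Q Y))))))))" (is "p_subgroup 3 G (?g (insert C ?X))")
  proof (rule p_subgroup_generate_insert[OF fin _ p6])
    fix x assume "x \<in> ?X"
    then consider "x = B" | "x = A" | "x = K" | "x = H" | "x = F" | "x = Q" | "x \<in> Y" by blast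
    then show "\<exists>r\<in>?g ?X. C \<otimes> x = r \<otimes> x \<otimes> C"
    proof cases
      case 1
      then show ?thesis using flip[OF FHK(2)] c by (auto intro!: bexI[of _ "inv H"] generate.inv)
    next
      case 2
      then show ?thesis using FHK(3) c by (auto intro!: bexI[of _ K] generate.incl)
    next
      case 3
      then show ?thesis using comm_ex[OF comm(7)[symmetric]] c by simp
    next
      case 4
      then show ?thesis using comm_ex[OF comm(5)[symmetric]] c by simp
    next
      case 5
      then show ?thesis using third'[OF third(2)] gQ[OF ks(1), of ?X] c Yc[OF ks(1)] by blast
    next
      case 6
      then show ?thesis using flip[OF central(6)] gY[OF zs'(3), of ?X] c Yc[OF zs(3)] by blast
    next
      case 7
      then show ?thesis using Ycomm[of x C] by simp
    qed
  qed (use Yc c cube in force)+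
  show ?thesis
    by (rule p_subgroup_subset[OF p7]) (use c in \<open>auto intro!: generate_is_subgroup mono_generate\<close>)
qed

end

section \<open>Commutative Moufang loops of exponent three\<close>

text \<open>Below, $i\ x = xx$ is the inverse of $x$, $s\ x\ y = (xy)^{-1}$ is the third point on the line
  through $x$ and $y$ in the associated distributive quasigroup, $d\ x\ y$ is the commutator of the
  translations $L_x$ and $L_y$, and $r\ a\ b\ c$ is the associator of $a$, $b$ and $c$.\<close>

locale exp3_cml =
  fixes B :: "'a set" and m :: "'a \<Rightarrow> 'a \<Rightarrow> 'a" (infixl "\<cdot>" 70) and e :: 'a
  assumes fin: "finite B" and e_in [simp]: "e \<in> B"
    and closed [simp]: "x \<in> B \<Longrightarrow> y \<in> B \<Longrightarrow> x \<cdot> y \<in> B"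
    and comm: "x \<in> B \<Longrightarrow> y \<in> B \<Longrightarrow> x \<cdot> y = y \<cdot> x"
    and unit_l [simp]: "x \<in> B \<Longrightarrow> e \<cdot> x = x"
    and cml: "x \<in> B \<Longrightarrow> y \<in> B \<Longrightarrow> z \<in> B \<Longrightarrow> (x \<cdot> x) \<cdot> (y \<cdot> z) = (x \<cdot> y) \<cdot> (x \<cdot> z)"
    and sq_cancel: "x \<in> B \<Longrightarrow> z \<in> B \<Longrightarrow> (x \<cdot> x) \<cdot> (x \<cdot> z) = z"
begin

definition i where "i x = x \<cdot> x"
definition s where "s x y = i (x \<cdot> y)"
definition d where "d x y z = x \<cdot> (y \<cdot> (i x \<cdot> (i y \<cdot> z)))"

lemma i_in [simp]: "x \<in> B \<Longrightarrow> i x \<in> B" by (simp add: i_def)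
lemma s_in [simp]: "x \<in> B \<Longrightarrow> y \<in> B \<Longrightarrow> s x y \<in> B" by (simp add: s_def)
lemma d_in [simp]: "x \<in> B \<Longrightarrow> y \<in> B \<Longrightarrow> z \<in> B \<Longrightarrow> d x y z \<in> B" by (simp add: d_def)

lemma unit_r [simp]: "x \<in> B \<Longrightarrow> x \<cdot> e = x" using comm[of x e] by simp
lemma i_cancel [simp]: "x \<in> B \<Longrightarrow> z \<in> B \<Longrightarrow> i x \<cdot> (x \<cdot> z) = z" by (simp add: i_def sq_cancel)
lemma i_mult: "x \<in> B \<Longrightarrow> z \<in> B \<Longrightarrow> i x \<cdot> z = x \<cdot> (x \<cdot> z)"
  using cml[of x e z] by (simp add: i_def)
lemma cancel_i [simp]: "x \<in> B \<Longrightarrow> z \<in> B \<Longrightarrow> x \<cdot> (i x \<cdot> z) = z"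
  using i_cancel[of x z] by (simp add: i_mult)
lemma i_left [simp]: "x \<in> B \<Longrightarrow> i x \<cdot> x = e" using i_cancel[of x e] by simp
lemma i_right [simp]: "x \<in> B \<Longrightarrow> x \<cdot> i x = e" using i_left[of x] by (simp add: comm)
lemma i_i [simp]: "x \<in> B \<Longrightarrow> i (i x) = x" using i_cancel[of x x] by (simp add: i_def)
lemma i_e [simp]: "i e = e" by (simp add: i_def)
lemma i_hom: "x \<in> B \<Longrightarrow> y \<in> B \<Longrightarrow> i (x \<cdot> y) = i x \<cdot> i y"
  using cml[of x y y] by (simp add: i_def)
lemma cml_i: "x \<in> B \<Longrightarrow> y \<in> B \<Longrightarrow> z \<in> B \<Longrightarrow> (x \<cdot> y) \<cdot> (x \<cdot> z) = i x \<cdot> (y \<cdot> z)"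
  using cml[of x y z] by (simp add: i_def)
lemma sq [simp]: "x \<in> B \<Longrightarrow> x \<cdot> x = i x" by (simp add: i_def)

lemma cancel_left: "x \<in> B \<Longrightarrow> y \<in> B \<Longrightarrow> z \<in> B \<Longrightarrow> x \<cdot> y = x \<cdot> z \<longleftrightarrow> y = z"
  by (metis i_cancel)

lemma mult_mult: "x \<in> B \<Longrightarrow> y \<in> B \<Longrightarrow> z \<in> B \<Longrightarrow> (x \<cdot> y) \<cdot> z = i x \<cdot> (y \<cdot> (i x \<cdot> z))"
  using cml_i[of x y "i x \<cdot> z"] by simp

text \<open>The Moufang law turns the product of \<open>x u\<close> and \<open>x v\<close> into
  \<open>i x\<close> times \<open>u v\<close>, and inverting turns \<open>i x\<close> back into x.
  So left translations, which do not respect the loop product, do respect \<open>s\<close>, and so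
  do all their composites. A composite that fixes \<open>e\<close> then respects the product as
  well, because the product is expressed by \<open>s\<close> and \<open>e\<close>; this gives
  \<open>d_mult\<close>.\<close>

lemma s_left_mult: "x \<in> B \<Longrightarrow> u \<in> B \<Longrightarrow> v \<in> B \<Longrightarrow> s (x \<cdot> u) (x \<cdot> v) = x \<cdot> s u v"
  by (simp add: s_def cml_i i_hom)

lemma mult_via_s: "u \<in> B \<Longrightarrow> v \<in> B \<Longrightarrow> u \<cdot> v = s e (s u v)" by (simp add: s_def)

section \<open>Commutators of left translations\<close>

lemma d_s: "x \<in> B \<Longrightarrow> y \<in> B \<Longrightarrow> u \<in> B \<Longrightarrow> v \<in> B \<Longrightarrow> d x y (s u v) = s (d x y u) (d x y v)"
  by (simp add: d_def s_left_mult)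
lemma d_e [simp]: "x \<in> B \<Longrightarrow> y \<in> B \<Longrightarrow> d x y e = e"
  by (simp add: d_def comm[of "i x" "i y"])
lemma d_mult: "x \<in> B \<Longrightarrow> y \<in> B \<Longrightarrow> u \<in> B \<Longrightarrow> v \<in> B \<Longrightarrow> d x y (u \<cdot> v) = d x y u \<cdot> d x y v"
  using d_s[of x y e "s u v"] d_s[of x y u v] by (simp add: mult_via_s[of u v] mult_via_s[of "d x y u" "d x y v"])
lemma d_i: "x \<in> B \<Longrightarrow> y \<in> B \<Longrightarrow> u \<in> B \<Longrightarrow> d x y (i u) = i (d x y u)"
  using d_mult[of x y u u] by simp
lemma d_1 [simp]: "x \<in> B \<Longrightarrow> y \<in> B \<Longrightarrow> d x y x = x"
  by (simp add: d_def comm[of "i y" x])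
lemma d_2 [simp]: "x \<in> B \<Longrightarrow> y \<in> B \<Longrightarrow> d x y y = y"
  by (simp add: d_def comm[of y "i x"])

text \<open>As maps, \<open>L_x L_y\<close> is \<open>d x y\<close> applied after
  \<open>L_y L_x\<close>; being a homomorphism that fixes x and y, \<open>d x y\<close> passes
  through both factors and lands on z.\<close>

lemma d_swap: "x \<in> B \<Longrightarrow> y \<in> B \<Longrightarrow> z \<in> B \<Longrightarrow> x \<cdot> (y \<cdot> z) = y \<cdot> (x \<cdot> d x y z)"
  using d_mult[of x y y "x \<cdot> z"] d_mult[of x y x z] by (simp add: d_def[of x y "y \<cdot> (x \<cdot> z)"])

lemma d_eqI: "x \<in> B \<Longrightarrow> y \<in> B \<Longrightarrow> z \<in> B \<Longrightarrow> w \<in> B \<Longrightarrow> x \<cdot> (y \<cdot> z) = y \<cdot> (x \<cdot> w) \<Longrightarrow> d x y z = w"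
  using d_swap[of x y z] by (simp add: cancel_left)

lemma d_inverse [simp]: "x \<in> B \<Longrightarrow> y \<in> B \<Longrightarrow> z \<in> B \<Longrightarrow> d x y (d y x z) = z"
  by (rule d_eqI) (simp_all add: d_swap[symmetric])

text \<open>Three translations by y cancel, so taking x past them has no effect, whereas by
  \<open>d_swap\<close> each passage contributes one \<open>d x y\<close>.\<close>

lemma d_cube: assumes "x \<in> B" "y \<in> B" "z \<in> B" shows "d x y (d x y (d x y z)) = z"
proof -
  let ?f = "d x y"
  have "x \<cdot> (y \<cdot> (y \<cdot> (y \<cdot> z))) = y \<cdot> (y \<cdot> (y \<cdot> (x \<cdot> ?f (?f (?f z)))))"
    using assms d_swap[of x y "y \<cdot> (y \<cdot> z)"] d_swap[of x y "y \<cdot> ?f z"] d_swap[of x y "?f (?f z)"]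
    by (simp add: d_mult)
  then show ?thesis using assms by (simp add: i_mult[symmetric] cancel_left)
qed

lemma d_swap_args: assumes "x \<in> B" "y \<in> B" "z \<in> B" shows "d y x z = d x y (d x y z)"
  using d_inverse[of y x "d x y (d x y z)"] d_cube assms by simp

lemma d_i_left: assumes "x \<in> B" "y \<in> B" "z \<in> B" shows "d (i x) y z = d y x z"
proof (rule d_eqI)
  have "y \<cdot> (i x \<cdot> d y x z) = i x \<cdot> (x \<cdot> (y \<cdot> (i x \<cdot> d y x z)))" using assms by simp
  also have "\<dots> = i x \<cdot> (y \<cdot> (x \<cdot> d x y (i x \<cdot> d y x z)))" using assms d_swap[of x y "i x \<cdot> d y x z"] by simp
  also have "\<dots> = i x \<cdot> (y \<cdot> z)" using assms by (simp add: d_mult d_i)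
  finally show "i x \<cdot> (y \<cdot> z) = y \<cdot> (i x \<cdot> d y x z)" by simp
qed (use assms in simp_all)

lemma d_i_right: assumes "x \<in> B" "y \<in> B" "z \<in> B" shows "d x (i y) z = d y x z"
proof -
  have "d x (i y) (d (i y) x z) = z" using assms by (intro d_inverse) simp_all
  then have "d x (i y) (d x y z) = z" using assms by (simp add: d_i_left)
  then have "d x (i y) (d x y (d y x z)) = d y x z" using assms by (metis d_in d_inverse d_i_left d_swap_args i_in)
  then show ?thesis using assms by simp
qed

text \<open>The commutator of the two translations is at the same time the left inner mapping
  \<open>L_{xy}^-1 L_x L_y\<close>. This is the link between \<open>d\<close> and
  associativity.\<close>

lemma mult_d: assumes "x \<in> B" "y \<in> B" "z \<in> B" shows "(x \<cdot> y) \<cdot> d y x z = x \<cdot> (y \<cdot> z)"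
proof -
  have "(x \<cdot> y) \<cdot> d y x z = i x \<cdot> (y \<cdot> (i x \<cdot> d y x z))" using assms by (simp add: mult_mult)
  also have "\<dots> = i x \<cdot> (i x \<cdot> (y \<cdot> z))"
    using assms by (simp add: d_swap[of "i x" y z] d_i_left)
  also have "\<dots> = x \<cdot> (y \<cdot> z)" using assms by (simp flip: i_mult[of "i x"])
  finally show ?thesis .
qed

lemma d_mult_right: assumes "x \<in> B" "y \<in> B" "z \<in> B" shows "d x (x \<cdot> y) z = d x y z"
proof (rule d_eqI)
  have "(x \<cdot> y) \<cdot> (x \<cdot> d x y z) = i x \<cdot> (y \<cdot> d x y z)" using assms by (simp add: cml_i)
  also have "\<dots> = y \<cdot> (i x \<cdot> z)"
    using assms by (simp add: d_swap[of "i x" y "d x y z"] d_i_left)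
  also have "\<dots> = x \<cdot> ((x \<cdot> y) \<cdot> z)" using assms by (simp add: mult_mult)
  finally show "x \<cdot> ((x \<cdot> y) \<cdot> z) = (x \<cdot> y) \<cdot> (x \<cdot> d x y z)" by simp
qed (use assms in simp_all)

text \<open>Skew symmetry of the associator in two arguments, stated before associators are
  available. By \<open>mult_d\<close>, \<open>d x u v\<close> depends only on u and on the product
  of u and v; the two values for (y, z) and (z, y) thus share the factor \<open>?p\<close>, and the
  Moufang law multiplies them.\<close>

lemma d_alternating: assumes "x \<in> B" "y \<in> B" "z \<in> B" shows "d x y z \<cdot> d x z y = y \<cdot> z"
proof -
  let ?p = "i x \<cdot> (y \<cdot> z)"
  have *: "d x u v = ?p \<cdot> (x \<cdot> i u)" if "u \<in> B" "v \<in> B" "u \<cdot> v = y \<cdot> z" for u v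
  proof -
    have "(i x \<cdot> u) \<cdot> d u (i x) v = ?p" using mult_d[of "i x" u v] assms that by simp
    moreover have "d u (i x) v = d x u v"
      using that assms by (simp add: d_i_right)
    ultimately have "d x u v = i (i x \<cdot> u) \<cdot> ?p" using that assms by (metis i_cancel closed d_in i_in)
    then show ?thesis using that assms by (simp add: i_hom comm)
  qed
  have "d x y z \<cdot> d x z y = (?p \<cdot> (x \<cdot> i y)) \<cdot> (?p \<cdot> (x \<cdot> i z))"
    using *[of y z] *[of z y] assms by (simp add: comm[of z y])
  also have "\<dots> = i ?p \<cdot> (i x \<cdot> (i y \<cdot> i z))" using assms by (simp add: cml_i)
  also have "\<dots> = (x \<cdot> i (y \<cdot> z)) \<cdot> (i x \<cdot> i (y \<cdot> z))" using assms by (simp add: i_hom)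
  also have "\<dots> = y \<cdot> z"
    using assms comm[of x "i (y \<cdot> z)"] comm[of "i x" "i (y \<cdot> z)"] cml_i[of "i (y \<cdot> z)" x "i x"] by simp
  finally show ?thesis .
qed

lemma d_exchange: assumes "x \<in> B" "y \<in> B" "z \<in> B" shows "d x z y = (y \<cdot> z) \<cdot> i (d x y z)"
proof -
  have "d x z y = i (d x y z) \<cdot> (y \<cdot> z)"
    using d_alternating[OF assms, symmetric] assms by simp
  then show ?thesis using assms by (simp add: comm)
qed

text \<open>After \<open>d_exchange\<close> x stands in the second place, where
  \<open>d_mult_right\<close> lets it be absorbed into the first argument.\<close>

lemma d_mult_1: assumes "x \<in> B" "y \<in> B" "z \<in> B" shows "d (x \<cdot> y) z x = d y z x"
proof -
  have "d (x \<cdot> y) x w = d y x w" if "w \<in> B" for w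
    using that assms d_mult_right[of x y] d_swap_args[of x "x \<cdot> y" w] d_swap_args[of x y w] by simp
  then show ?thesis using assms d_exchange[of "x \<cdot> y" x z] d_exchange[of y x z] by simp
qed

lemma d_mult_2: assumes "x \<in> B" "y \<in> B" "z \<in> B" shows "d x (y \<cdot> z) y = d x z y"
proof -
  have conv: "d (i w) x (i y) = i (d x w y)" if "w \<in> B" for w
    using that assms by (simp add: d_i d_i_left)
  have "i (d x (y \<cdot> z) y) = d (i y \<cdot> i z) x (i y)"
    using conv[of "y \<cdot> z"] assms by (simp add: i_hom)
  also have "\<dots> = d (i z) x (i y)" using assms by (intro d_mult_1) simp_all
  also have "\<dots> = i (d x z y)" using conv[of z] assms by simp
  finally show ?thesis using assms by (metis closed d_in i_i)
qed

text \<open>Both sides equal \<open>d u (y (x z)) y\<close> for u = \<open>y x\<close>. Once u is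
  reduced to x and the factors y and x are dropped from the second argument; once
  \<open>mult_d\<close> rewrites that argument as u times \<open>d x y z\<close>, from which u is
  dropped.\<close>

lemma d_d: assumes "x \<in> B" "y \<in> B" "z \<in> B" shows "d x (d x y z) y = d x z y"
proof -
  let ?u = "y \<cdot> x"
  have "d ?u (y \<cdot> (x \<cdot> z)) y = d x (y \<cdot> (x \<cdot> z)) y"
    using assms by (simp add: d_mult_1)
  also have "\<dots> = d x (x \<cdot> z) y" using assms by (simp add: d_mult_2)
  also have "\<dots> = d x z y" using assms by (simp add: d_mult_right)
  finally have "d ?u (y \<cdot> (x \<cdot> z)) y = d x z y" .
  moreover have "d ?u (y \<cdot> (x \<cdot> z)) y = d ?u (d x y z) y"
    using mult_d[of y x z] d_mult_right[of ?u "d x y z" y] assms by simp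
  moreover have "d ?u (d x y z) y = d x (d x y z) y" using assms by (simp add: d_mult_1)
  ultimately show ?thesis by simp
qed

text \<open>With f = \<open>d x y\<close> this is \<open>f (f z) = s z (f z)\<close>: the orbit of z
  under f is a line. In additive notation of characteristic 3 it reads \<open>(f - 1)^2 = 0\<close>,
  so commutators of translations act unipotently. The proof computes \<open>d x z y\<close> once by
  \<open>d_alternating\<close> and once by \<open>d_exchange\<close> and \<open>d_d\<close>, and
  solves for \<open>f (f z)\<close>.\<close>

lemma d_line: assumes "x \<in> B" "y \<in> B" "z \<in> B" shows "i (d x y (d x y z)) = z \<cdot> d x y z"
proof -
  let ?u = "d x y z" and ?k = "d x z y"
  let ?f = "d x y ?u"
  have uk: "?u \<cdot> ?k = y \<cdot> z" using d_alternating assms by blast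
  have "d x ?u y = (y \<cdot> ?u) \<cdot> i ?f" using d_exchange[of x y ?u] assms by simp
  then have k: "?k = (y \<cdot> ?u) \<cdot> i ?f" using d_d assms by simp
  have "i ?k = i (y \<cdot> ?u) \<cdot> ?f" unfolding k using assms by (simp add: i_hom)
  also have "\<dots> = y \<cdot> (i ?u \<cdot> (y \<cdot> ?f))"
    using mult_mult[of "i y" "i ?u" ?f] assms by (simp add: i_hom)
  finally have "i y \<cdot> i ?k = i ?u \<cdot> (y \<cdot> ?f)" using assms by simp
  then have "y \<cdot> ?f = ?u \<cdot> (i y \<cdot> i ?k)" using assms by (metis cancel_i closed d_in i_in)
  then have "i (y \<cdot> ?f) = i ?u \<cdot> (y \<cdot> ?k)" using assms by (simp add: i_hom)
  also have "\<dots> = (?u \<cdot> y) \<cdot> (?u \<cdot> ?k)" using assms by (simp add: cml_i)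
  also have "\<dots> = (y \<cdot> ?u) \<cdot> (y \<cdot> z)" using uk assms by (simp add: comm)
  also have "\<dots> = i y \<cdot> (?u \<cdot> z)" using assms by (simp add: cml_i)
  finally have "i y \<cdot> i ?f = i y \<cdot> (?u \<cdot> z)" using assms by (simp add: i_hom)
  then show ?thesis using assms by (simp add: cancel_left comm)
qed


text \<open>By commutativity these are the three ways of bracketing a, b, c, and
  \<open>d a b\<close> permutes them cyclically: one step is \<open>d_swap\<close>, one is
  \<open>mult_d\<close>, and the last follows as the cube of \<open>d a b\<close> is
  trivial.\<close>

lemma d_rot: assumes "a \<in> B" "b \<in> B" "c \<in> B"
  shows "d a b (b \<cdot> (c \<cdot> a)) = a \<cdot> (b \<cdot> c)" "d a b (c \<cdot> (a \<cdot> b)) = b \<cdot> (c \<cdot> a)"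
    "d a b (a \<cdot> (b \<cdot> c)) = c \<cdot> (a \<cdot> b)"
proof -
  show 1: "d a b (b \<cdot> (c \<cdot> a)) = a \<cdot> (b \<cdot> c)"
    using d_swap[of a b c] assms by (simp add: d_mult comm[of _ a])
  show 2: "d a b (c \<cdot> (a \<cdot> b)) = b \<cdot> (c \<cdot> a)"
    using mult_d[of b a c] assms by (simp add: d_mult comm)
  show "d a b (a \<cdot> (b \<cdot> c)) = c \<cdot> (a \<cdot> b)"
    using d_cube[of a b "c \<cdot> (a \<cdot> b)"] assms by (simp add: 1 2)
qed

lemma d_fix_assoc: assumes "x \<in> B" "y \<in> B" "z \<in> B" "d x y z = z"
  shows "y \<cdot> (z \<cdot> x) = z \<cdot> (x \<cdot> y)"
  using d_rot(2)[of x y z] assms by (simp add: d_mult)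

text \<open>A fixed point means that the three bracketings of x, y, z agree, which is a symmetric
  condition. With \<open>d_fix_swap\<close> it can be moved to any order of the arguments.\<close>

lemma d_fix_rot: assumes "x \<in> B" "y \<in> B" "z \<in> B" "d x y z = z" shows "d y z x = x"
proof (rule d_eqI)
  show "y \<cdot> (z \<cdot> x) = z \<cdot> (y \<cdot> x)"
    using d_fix_assoc[OF assms] comm[OF assms(2,1)] by (simp only:)
qed (use assms in simp_all)

lemma d_fix_swap: assumes "x \<in> B" "y \<in> B" "z \<in> B" "d x y z = z" shows "d y x z = z"
  using assms by (simp add: d_swap_args[of x y z])

text \<open>The second half of \<open>(f - 1)^2 = 0\<close> from \<open>d_line\<close>: the
  displacement of a point under \<open>d x y\<close> is itself fixed.\<close>

lemma d_fix_quotient: assumes "x \<in> B" "y \<in> B" "z \<in> B" 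
  shows "d x y (i z \<cdot> d x y z) = i z \<cdot> d x y z"
proof -
  have "d x y (d x y z) = i z \<cdot> i (d x y z)"
    using arg_cong[OF d_line[of x y z], of i] assms by (simp add: i_hom)
  then have "d x y (i z \<cdot> d x y z) = i (d x y z) \<cdot> (i (d x y z) \<cdot> i z)"
    using assms by (simp add: d_mult d_i comm)
  also have "\<dots> = i z \<cdot> d x y z" using assms i_mult[of "i (d x y z)" "i z"] comm[of "d x y z" "i z"] by simp
  finally show ?thesis .
qed

section \<open>Associators of three elements\<close>

definition r where "r a b c = i (b \<cdot> (c \<cdot> a)) \<cdot> (a \<cdot> (b \<cdot> c))"

lemma r_in [simp]: "a \<in> B \<Longrightarrow> b \<in> B \<Longrightarrow> c \<in> B \<Longrightarrow> r a b c \<in> B" by (simp add: r_def)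

text \<open>All of \<open>d a b\<close>, \<open>d b c\<close> and \<open>d c a\<close> take the
  bracketing \<open>b (c a)\<close> to \<open>a (b c)\<close>. Hence \<open>r a b c\<close> is the
  displacement of one point under each of the three, and \<open>d_fix_quotient\<close> applies three
  times.\<close>

lemma r_fixed: assumes "a \<in> B" "b \<in> B" "c \<in> B"
  shows "d a b (r a b c) = r a b c" "d b c (r a b c) = r a b c" "d c a (r a b c) = r a b c"
  unfolding r_def using d_fix_quotient[of a b "b \<cdot> (c \<cdot> a)"] d_fix_quotient[of b c "b \<cdot> (c \<cdot> a)"]
     d_fix_quotient[of c a "b \<cdot> (c \<cdot> a)"] d_rot(1)[of a b c] d_rot(3)[of b c a] d_rot(2)[of c a b] assms
  by simp_all

lemma r_rot: assumes "a \<in> B" "b \<in> B" "c \<in> B" shows "r b c a = r a b c"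
proof -
  have "d b c (r b c a) = i (d b c (c \<cdot> (a \<cdot> b))) \<cdot> d b c (b \<cdot> (c \<cdot> a))"
    using assms by (simp add: r_def d_mult d_i)
  also have "\<dots> = r a b c" using d_rot(1,3)[of b c a] assms by (simp add: r_def)
  finally show ?thesis using r_fixed(1)[of b c a] assms by simp
qed

text \<open>Class at most 2 in the form used later: the associator associates with any two of a, b,
  c. It comes from \<open>r_fixed\<close> by permuting arguments with \<open>d_fix_rot\<close> and
  \<open>d_fix_swap\<close>.\<close>

lemma r_nuclear: assumes "a \<in> B" "b \<in> B" "c \<in> B" "x \<in> {a, b, c}" "y \<in> {a, b, c}"
  shows "d (r a b c) x y = y" "d x (r a b c) y = y"
proof -
  let ?r = "r a b c"
  have 1: "d b ?r a = a" "d c ?r b = b" "d a ?r c = c"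
    using d_fix_rot[of a b ?r] d_fix_rot[of b c ?r] d_fix_rot[of c a ?r] r_fixed[of a b c] assms by simp_all
  have 2: "d ?r a b = b" "d ?r b c = c" "d ?r c a = a"
    using 1 d_fix_rot[of b ?r a] d_fix_rot[of c ?r b] d_fix_rot[of a ?r c] assms by simp_all
  have 3: "d ?r b a = a" "d ?r c b = b" "d ?r a c = c"
    using 1 d_fix_swap[of b ?r a] d_fix_swap[of c ?r b] d_fix_swap[of a ?r c] assms by simp_all
  have "\<forall>x\<in>{a, b, c}. \<forall>y\<in>{a, b, c}. d ?r x y = y"
    using 2 3 assms by auto
  then show "d ?r x y = y" using assms by blast
  then show "d x ?r y = y" using d_fix_swap[of ?r x y] assms by auto
qed

text \<open>\<open>r_nuclear\<close> lets the associator travel through b and a until it meets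
  c.\<close>

lemma d_eq_r: assumes "a \<in> B" "b \<in> B" "c \<in> B" shows "d a b c = r a b c \<cdot> c"
proof -
  let ?r = "r a b c"
  have "b \<cdot> (a \<cdot> d a b c) = a \<cdot> (b \<cdot> c)" using d_swap[of a b c] assms by simp
  also have "\<dots> = (b \<cdot> (c \<cdot> a)) \<cdot> ?r" using assms by (simp add: r_def)
  also have "\<dots> = ?r \<cdot> (b \<cdot> (a \<cdot> c))" using assms by (simp add: comm)
  also have "\<dots> = b \<cdot> (?r \<cdot> (a \<cdot> c))"
    using d_swap[of ?r b "a \<cdot> c"] r_nuclear(1)[of a b c b] assms by (simp add: d_mult)
  also have "\<dots> = b \<cdot> (a \<cdot> (?r \<cdot> c))"
    using d_swap[of ?r a c] r_nuclear(1)[of a b c a] assms by simp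
  finally show ?thesis using assms by (simp add: cancel_left)
qed

end

lemma (in group) generate_commute:
  assumes "S \<subseteq> carrier G" "g \<in> carrier G" and comm: "\<And>x. x \<in> S \<Longrightarrow> g \<otimes> x = x \<otimes> g" and "w \<in> generate G S"
  shows "g \<otimes> w = w \<otimes> g"
  using assms(4)
proof (induction rule: generate.induct)
  case one
  then show ?case using assms by simp
next
  case (incl h)
  then show ?case using comm by simp
next
  case (inv h)
  then have "h \<in> carrier G" and "g \<otimes> h = h \<otimes> g" using assms comm by auto
  have "g \<otimes> inv h = inv h \<otimes> (h \<otimes> g) \<otimes> inv h" using \<open>h \<in> carrier G\<close> assms(2) by (simp add: m_assoc[symmetric])
  also have "\<dots> = inv h \<otimes> (g \<otimes> h) \<otimes> inv h" using \<open>g \<otimes> h = h \<otimes> g\<close> by simp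
  also have "\<dots> = inv h \<otimes> g" using \<open>h \<in> carrier G\<close> assms(2) by (simp add: m_assoc)
  finally show ?case .
next
  case (eng h k)
  then have "h \<in> carrier G" "k \<in> carrier G" using assms(1) generate_in_carrier by blast+
  then show ?case using eng assms(2) by (metis m_assoc)
qed

text \<open>The maps are the identity outside B, so that composition needs no restriction and
  equality of functions can be tested on B.\<close>

definition quasigroup_auts :: "'a set \<Rightarrow> ('a \<Rightarrow> 'a \<Rightarrow> 'a) \<Rightarrow> ('a \<Rightarrow> 'a) monoid" where
  "quasigroup_auts B s =
    \<lparr>carrier = {g. g permutes B \<and> (\<forall>x\<in>B. \<forall>y\<in>B. g (s x y) = s (g x) (g y))}, monoid.mult = (\<circ>), one = id\<rparr>"

lemma quasigroup_auts_simps [simp]: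
  "monoid.mult (quasigroup_auts B s) = (\<circ>)" "one (quasigroup_auts B s) = id"
  by (simp_all add: quasigroup_auts_def)

lemma mem_quasigroup_auts:
  "g \<in> carrier (quasigroup_auts B s) \<longleftrightarrow> g permutes B \<and> (\<forall>x\<in>B. \<forall>y\<in>B. g (s x y) = s (g x) (g y))"
  by (simp add: quasigroup_auts_def)

lemma quasigroup_auts_group:
  assumes "\<And>x y. x \<in> B \<Longrightarrow> y \<in> B \<Longrightarrow> s x y \<in> B"
  shows "group (quasigroup_auts B s)"
proof (rule groupI)
  fix g assume g: "g \<in> carrier (quasigroup_auts B s)"
  then have p: "g permutes B" by (simp add: mem_quasigroup_auts)
  let ?h = "inv_into UNIV g"
  have hp: "?h permutes B" using permutes_inv[OF p] .
  have "?h (s x y) = s (?h x) (?h y)" if "x \<in> B" "y \<in> B" for x y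
  proof -
    have "?h x \<in> B" "?h y \<in> B" using that permutes_in_image[OF hp] by auto
    then have "g (s (?h x) (?h y)) = s x y"
      using g that permutes_inverses[OF p] by (simp add: mem_quasigroup_auts)
    then show ?thesis using permutes_inverses[OF p] by metis
  qed
  then have "?h \<in> carrier (quasigroup_auts B s)" using hp by (simp add: mem_quasigroup_auts)
  moreover have "?h \<circ> g = id" using permutes_inv_o[OF p] by simp
  ultimately show "\<exists>h\<in>carrier (quasigroup_auts B s). h \<otimes>\<^bsub>quasigroup_auts B s\<^esub> g = \<one>\<^bsub>quasigroup_auts B s\<^esub>"
    by auto
next
  fix g h assume "g \<in> carrier (quasigroup_auts B s)" "h \<in> carrier (quasigroup_auts B s)"
  then show "g \<otimes>\<^bsub>quasigroup_auts B s\<^esub> h \<in> carrier (quasigroup_auts B s)"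
    by (auto simp: mem_quasigroup_auts permutes_compose permutes_in_image)
qed (auto simp: mem_quasigroup_auts permutes_id comp_assoc)

lemma finite_quasigroup_auts: "finite B \<Longrightarrow> finite (carrier (quasigroup_auts B s))"
  by (rule finite_subset[OF _ finite_permutations[of B]]) (auto simp: mem_quasigroup_auts)

lemma quasigroup_auts_eqI:
  assumes "g \<in> carrier (quasigroup_auts B s)" "h \<in> carrier (quasigroup_auts B s)" "\<And>p. p \<in> B \<Longrightarrow> g p = h p"
  shows "g = h"
  using assms by (metis ext mem_quasigroup_auts permutes_not_in)

section \<open>Translations by three elements generate a 3-group\<close>

context exp3_cml
begin

abbreviation "G \<equiv> quasigroup_auts B s"

sublocale G: group G
  by (rule quasigroup_auts_group) simp

lemma finite_G: "finite (carrier G)" using fin by (rule finite_quasigroup_auts)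

definition L where "L x = (\<lambda>z. if z \<in> B then x \<cdot> z else z)"
definition D where "D x y = (\<lambda>z. if z \<in> B then d x y z else z)"
definition \<sigma> where "\<sigma> x = (\<lambda>z. if z \<in> B then s x z else z)"

lemma L_apply [simp]: "z \<in> B \<Longrightarrow> L x z = x \<cdot> z" by (simp add: L_def)
lemma D_apply [simp]: "z \<in> B \<Longrightarrow> D x y z = d x y z" by (simp add: D_def)
lemma \<sigma>_apply [simp]: "z \<in> B \<Longrightarrow> \<sigma> x z = s x z" by (simp add: \<sigma>_def)

lemma L_in [simp]: assumes "x \<in> B" shows "L x \<in> carrier G"
proof -
  have "bij_betw (L x) B B"
    by (rule bij_betw_byWitness[where f' = "L (i x)"]) (use assms in auto)
  then have "L x permutes B" by (rule bij_imp_permutes) (simp add: L_def)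
  then show ?thesis using assms by (simp add: mem_quasigroup_auts s_left_mult)
qed

lemma D_in [simp]: assumes "x \<in> B" "y \<in> B" shows "D x y \<in> carrier G"
proof -
  have "bij_betw (D x y) B B"
    by (rule bij_betw_byWitness[where f' = "D y x"]) (use assms in auto)
  then have "D x y permutes B" by (rule bij_imp_permutes) (simp add: D_def)
  then show ?thesis using assms by (simp add: mem_quasigroup_auts d_s)
qed

lemma s_s [simp]: "x \<in> B \<Longrightarrow> y \<in> B \<Longrightarrow> s x (s x y) = y"
  by (simp add: s_def i_hom)

lemma \<sigma>_in [simp]: assumes "x \<in> B" shows "\<sigma> x \<in> carrier G"
proof -
  have "bij_betw (\<sigma> x) B B"
    by (rule bij_betw_byWitness[where f' = "\<sigma> x"]) (use assms in auto)
  then have "\<sigma> x permutes B" by (rule bij_imp_permutes) (simp add: \<sigma>_def)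
  moreover have "s x (s u v) = s (s x u) (s x v)" if "u \<in> B" "v \<in> B" for u v
    using that assms by (simp add: s_def i_hom cml_i)
  ultimately show ?thesis using assms by (simp add: mem_quasigroup_auts)
qed

lemma G_apply [simp]: "g \<in> carrier G \<Longrightarrow> z \<in> B \<Longrightarrow> g z \<in> B"
  by (auto simp: mem_quasigroup_auts permutes_in_image)

lemma G_s: "g \<in> carrier G \<Longrightarrow> x \<in> B \<Longrightarrow> y \<in> B \<Longrightarrow> g (s x y) = s (g x) (g y)"
  by (simp add: mem_quasigroup_auts)

lemma G_mult: "g \<in> carrier G \<Longrightarrow> g e = e \<Longrightarrow> x \<in> B \<Longrightarrow> y \<in> B \<Longrightarrow> g (x \<cdot> y) = g x \<cdot> g y"
  by (simp add: mult_via_s G_s)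

lemma G_i: "g \<in> carrier G \<Longrightarrow> g e = e \<Longrightarrow> x \<in> B \<Longrightarrow> g (i x) = i (g x)"
  using G_mult[of g x x] by simp

lemma G_comp [simp]: "g \<in> carrier G \<Longrightarrow> h \<in> carrier G \<Longrightarrow> g \<circ> h \<in> carrier G"
  using G.m_closed[of g h] by simp

lemma \<sigma>_conj: "g \<in> carrier G \<Longrightarrow> x \<in> B \<Longrightarrow> g \<circ> \<sigma> x = \<sigma> (g x) \<circ> g"
  by (rule quasigroup_auts_eqI[of _ B s]) (auto simp: G_s)

lemma comm_with_L: assumes "g \<in> carrier G" "g e = e" "x \<in> B" "g x = x" shows "g \<circ> L x = L x \<circ> g"
  by (rule quasigroup_auts_eqI[of _ B s]) (use assms in \<open>auto simp: G_mult\<close>)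

lemma L_cube: "x \<in> B \<Longrightarrow> L x [^]\<^bsub>G\<^esub> (3::nat) = id"
  by (rule quasigroup_auts_eqI[of _ B s]) (auto simp: G.cube_eq G.one_closed[simplified] simp flip: i_mult)

lemma D_cube: "x \<in> B \<Longrightarrow> y \<in> B \<Longrightarrow> D x y [^]\<^bsub>G\<^esub> (3::nat) = id"
  by (rule quasigroup_auts_eqI[of _ B s]) (auto simp: G.cube_eq G.one_closed[simplified] d_cube)

lemma L_swap: "x \<in> B \<Longrightarrow> y \<in> B \<Longrightarrow> L x \<circ> L y = D x y \<circ> L y \<circ> L x"
  by (rule quasigroup_auts_eqI[of _ B s]) (auto simp: d_mult intro: d_swap)

text \<open>The relations demanded by \<open>three_generated_3_group\<close> hold with
  \<open>L ?r\<close> as Q and the maps \<open>D\<close> as F, H, K. They contain unknown central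
  factors, and class 2 makes centrality testable: it suffices to look at the points e, a, b,
  c.\<close>

lemma L_generate_3_group:
  assumes abc: "a \<in> B" "b \<in> B" "c \<in> B"
  shows "p_subgroup 3 G (generate G {L a, L b, L c})"
proof -
  let ?r = "r a b c"
  let ?S = "{L a, L b, L c, L ?r}"
  define W where "W = generate G ?S"
  have SG: "?S \<subseteq> carrier G" using abc by simp
  have W: "subgroup W G" unfolding W_def using SG by (rule G.generate_is_subgroup)
  have WG: "g \<in> carrier G" if "g \<in> W" for g using W that by (rule subgroup.mem_carrier)
  have W_comp: "g \<circ> h \<in> W" if "g \<in> W" "h \<in> W" for g h using subgroup.m_closed[OF W that] by simp
  have W_inv: "inv\<^bsub>G\<^esub> g \<in> W" if "g \<in> W" for g using subgroup.m_inv_closed[OF W that] .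
  have W_L: "L a \<in> W" "L b \<in> W" "L c \<in> W" "L ?r \<in> W" by (auto simp: W_def intro: generate.incl)
  have W_cancel: "z \<in> W" if "g \<in> W" "h \<in> W" "h = z \<circ> g" "z \<in> carrier G" for g h z
  proof -
    have "h \<otimes>\<^bsub>G\<^esub> inv\<^bsub>G\<^esub> g = z \<otimes>\<^bsub>G\<^esub> (g \<otimes>\<^bsub>G\<^esub> inv\<^bsub>G\<^esub> g)"
      using that(3,4) WG[OF that(1)] by (simp add: comp_assoc)
    then have "z = h \<otimes>\<^bsub>G\<^esub> inv\<^bsub>G\<^esub> g" using that(4) WG[OF that(1)] G.r_inv by simp
    then show ?thesis using W_comp[OF that(2) W_inv[OF that(1)]] by simp
  qed
  have W_D: "D x y \<in> W" if "x \<in> B" "y \<in> B" "L x \<in> W" "L y \<in> W" for x y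
    by (rule W_cancel[OF W_comp[OF that(4,3)] W_comp[OF that(3,4)]]) (use that L_swap[of x y] in \<open>simp_all add: comp_assoc\<close>)
  define Z where "Z = {g \<in> W. \<forall>w\<in>W. g \<circ> w = w \<circ> g}"
  \<comment> \<open>A map that fixes e is a loop homomorphism, so if it also fixes a, b, c then it
    fixes \<open>?r\<close>, and it commutes with the translations that generate W.\<close>
  have Z_I: "g \<in> Z" if g: "g \<in> W" "g e = e" "g a = a" "g b = b" "g c = c" for g
  proof -
    have gG: "g \<in> carrier G" using WG g(1) .
    have "g ?r = ?r" unfolding r_def using gG g abc by (simp add: G_mult G_i)
    then have "g \<circ> x = x \<circ> g" if "x \<in> ?S" for x
      using that g gG abc comm_with_L[OF gG g(2)] by auto
    then have "g \<circ> w = w \<circ> g" if "w \<in> W" for w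
      using G.generate_commute[OF SG gG, of w] that by (simp add: W_def)
    then show ?thesis using g(1) by (simp add: Z_def)
  qed
  have D_Z: "D ?r x \<in> Z" if "x \<in> {a, b, c}" for x
  proof (rule Z_I)
    show "D ?r x \<in> W" using that abc W_L by (intro W_D) auto
    have "x \<in> B" using that abc by auto
    then show "D ?r x e = e" "D ?r x a = a" "D ?r x b = b" "D ?r x c = c"
      using abc r_nuclear(1)[OF abc that, of a] r_nuclear(1)[OF abc that, of b] r_nuclear(1)[OF abc that, of c]
      by simp_all
  qed
  have dr: "d a b c = ?r \<cdot> c" "d b c a = ?r \<cdot> a" "d c a b = ?r \<cdot> b"
    using d_eq_r[of a b c] d_eq_r[of b c a] d_eq_r[of c a b] r_rot[of a b c] r_rot[of b c a] abc by simp_all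
  have rf: "d a b ?r = ?r" "d b c ?r = ?r" "d c a ?r = ?r" using r_fixed abc by auto
  \<comment> \<open>Both maps change each of a, b, c by at most the factor \<open>?r\<close>, never
    both the same point, and both fix \<open>?r\<close>. So they commute at these points, and their
    commutator k fixes e, a, b, c.\<close>
  have fin_Z: "\<exists>k\<in>Z. h \<circ> f = k \<circ> f \<circ> h"
    if f: "f \<in> W" "h \<in> W" and pts: "f e = e" "h e = e"
      "\<And>p. p \<in> {a, b, c} \<Longrightarrow> f p = p \<or> f p = ?r \<cdot> p"  "\<And>p. p \<in> {a, b, c} \<Longrightarrow> h p = p \<or> h p = ?r \<cdot> p"
      "\<And>p. p \<in> {a, b, c} \<Longrightarrow> f p = p \<or> h p = p" "f ?r = ?r" "h ?r = ?r" for f h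
  proof -
    have fh: "f \<in> carrier G" "h \<in> carrier G" using f WG by auto
    let ?k = "h \<circ> f \<circ> inv\<^bsub>G\<^esub> (f \<circ> h)"
    have kW: "?k \<in> W" using f by (intro W_comp W_inv)
    have kG: "?k \<in> carrier G" using WG[OF kW] .
    have "?k \<otimes>\<^bsub>G\<^esub> (f \<circ> h) = h \<circ> f \<circ> (inv\<^bsub>G\<^esub> (f \<circ> h) \<otimes>\<^bsub>G\<^esub> (f \<circ> h))" by (simp add: comp_assoc)
    also have "\<dots> = h \<circ> f" using G.l_inv[of "f \<circ> h"] fh by simp
    finally have k: "?k \<circ> (f \<circ> h) = h \<circ> f" by simp
    have k': "?k (f (h p)) = h (f p)" for p using fun_cong[OF k, of p] by simp
    have ke: "?k e = e" using k'[of e] pts(1,2) by simp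
    have kr: "?k ?r = ?r" using k'[of ?r] pts by simp
    have "?k p = p" if p: "p \<in> {a, b, c}" for p
    proof -
      have pB: "p \<in> B" using p abc by auto
      have rp: "f (?r \<cdot> p) = ?r \<cdot> f p" "h (?r \<cdot> p) = ?r \<cdot> h p"
        using fh pts pB abc by (simp_all add: G_mult)
      have "f (h p) = h (f p)" "f (h p) = p \<or> f (h p) = ?r \<cdot> p"
        using pts(3,4,5)[OF p] rp by metis+
      then have "?k p = p \<or> ?k (?r \<cdot> p) = ?r \<cdot> p" using k'[of p] by metis
      moreover have "?k (?r \<cdot> p) = ?r \<cdot> ?k p" using kG ke kr pB abc by (subst G_mult) simp_all
      ultimately show ?thesis using pB abc kG by (metis G_apply cancel_left r_in)
    qed
    then have "?k \<in> Z" using kW ke by (intro Z_I) auto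
    then show ?thesis using k by (metis comp_assoc)
  qed
  \<comment> \<open>Conjugation by \<open>D x y\<close> turns \<open>L z\<close> into the
    translation by \<open>?r z\<close>. This differs from \<open>L ?r\<close> after
    \<open>L z\<close> by an inner mapping, which \<open>r_nuclear\<close> shows to fix e, a, b,
    c.\<close>
  have third: "\<exists>k\<in>Z. D x y \<circ> L z = k \<circ> L ?r \<circ> L z \<circ> D x y"
    if xyz: "x \<in> {a, b, c}" "y \<in> {a, b, c}" "z \<in> {a, b, c}" and dz: "d x y z = ?r \<cdot> z" for x y z
  proof -
    have B: "x \<in> B" "y \<in> B" "z \<in> B" using xyz abc by auto
    have rB: "?r \<in> B" using abc by simp
    have xW: "L x \<in> W" "L y \<in> W" "L z \<in> W" using xyz W_L by auto
    have dW: "D x y \<in> W" using W_D[OF B(1,2) xW(1,2)] .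
    have eq: "D x y \<circ> L z = L (?r \<cdot> z) \<circ> D x y"
      by (rule quasigroup_auts_eqI[of _ B s]) (use B rB dz in \<open>auto simp: d_mult\<close>)
    have rzW: "L (?r \<cdot> z) \<in> W"
      by (rule W_cancel[OF dW W_comp[OF dW xW(3)] eq]) (use B rB in simp)
    let ?k = "L (?r \<cdot> z) \<circ> inv\<^bsub>G\<^esub> (L ?r \<circ> L z)"
    have kW: "?k \<in> W" using rzW W_L(4) xW(3) by (intro W_comp W_inv)
    have "?k \<otimes>\<^bsub>G\<^esub> (L ?r \<circ> L z) = L (?r \<cdot> z) \<circ> (inv\<^bsub>G\<^esub> (L ?r \<circ> L z) \<otimes>\<^bsub>G\<^esub> (L ?r \<circ> L z))"
      by (simp add: comp_assoc)
    also have "\<dots> = L (?r \<cdot> z)" using G.l_inv[of "L ?r \<circ> L z"] B rB by simp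
    finally have k: "?k \<circ> (L ?r \<circ> L z) = L (?r \<cdot> z)" by simp
    have kt: "?k t = t" if t: "t \<in> {e, a, b, c}" for t
    proof -
      have tB: "t \<in> B" using t abc by auto
      have fix_t: "d ?r z t = t" "d z ?r t = t" using t r_nuclear[OF abc xyz(3), of t] B rB by auto
      let ?w = "i z \<cdot> (i ?r \<cdot> t)"
      have "d z ?r ?w = ?w" using B rB tB fix_t by (simp add: d_mult d_i)
      then have "(?r \<cdot> z) \<cdot> ?w = ?r \<cdot> (z \<cdot> ?w)"
        using mult_d[of ?r z ?w] B rB tB by simp
      also have "\<dots> = t" using B rB tB by simp
      finally show ?thesis using fun_cong[OF k, of ?w] B rB tB by simp
    qed
    have kZ: "?k \<in> Z" using kW kt by (intro Z_I) auto
    have "?k \<circ> L ?r \<circ> L z = L (?r \<cdot> z)" using k by (simp only: comp_assoc)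
    then have "D x y \<circ> L z = ?k \<circ> L ?r \<circ> L z \<circ> D x y" using eq by (simp only:)
    then show ?thesis using kZ by (rule bexI)
  qed
  have "\<exists>k\<in>Z. D b c \<circ> D a b = k \<circ> D a b \<circ> D b c"
    by (rule fin_Z) (use abc W_L W_D dr rf in auto)
  then obtain zFH where zFH: "zFH \<in> Z" "D b c \<circ> D a b = zFH \<circ> D a b \<circ> D b c" by blast
  have "\<exists>k\<in>Z. D c a \<circ> D a b = k \<circ> D a b \<circ> D c a"
    by (rule fin_Z) (use abc W_L W_D dr rf in auto)
  then obtain zFK where zFK: "zFK \<in> Z" "D c a \<circ> D a b = zFK \<circ> D a b \<circ> D c a" by blast
  have "\<exists>k\<in>Z. D c a \<circ> D b c = k \<circ> D b c \<circ> D c a"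
    by (rule fin_Z) (use abc W_L W_D dr rf in auto)
  then obtain zHK where zHK: "zHK \<in> Z" "D c a \<circ> D b c = zHK \<circ> D b c \<circ> D c a" by blast
  obtain kF where kF: "kF \<in> Z" "D a b \<circ> L c = kF \<circ> L ?r \<circ> L c \<circ> D a b" using third[of a b c] dr by auto
  obtain kH where kH: "kH \<in> Z" "D b c \<circ> L a = kH \<circ> L ?r \<circ> L a \<circ> D b c" using third[of b c a] dr by auto
  obtain kK where kK: "kK \<in> Z" "D c a \<circ> L b = kK \<circ> L ?r \<circ> L b \<circ> D c a" using third[of c a b] dr by auto
  have comm_DL: "D x y \<circ> L z = L z \<circ> D x y" if "x \<in> B" "y \<in> B" "z \<in> B" "d x y z = z" for x y z
    using that by (intro comm_with_L) auto
  have W_elems: "{L a, L b, L c, L ?r, D a b, D b c, D c a} \<subseteq> W" using W_L W_D abc by auto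
  have Z_inv: "inv\<^bsub>G\<^esub> z \<in> Z" if "z \<in> Z" for z
  proof -
    have z: "z \<in> W" "\<And>w. w \<in> W \<Longrightarrow> z \<circ> w = w \<circ> z" using that by (auto simp: Z_def)
    have "inv\<^bsub>G\<^esub> z \<circ> w = w \<circ> inv\<^bsub>G\<^esub> z" if w: "w \<in> W" for w
      using G.generate_commute[of "{z}" w "inv\<^bsub>G\<^esub> z"] WG[OF w] WG[OF z(1)] z(2)[OF w] generate.inv[of z "{z}" G]
      by simp
    then show ?thesis using W_inv[OF z(1)] by (simp add: Z_def)
  qed
  have Z_comp: "z \<circ> w \<in> Z" if "z \<in> Z" "w \<in> Z" for z w
  proof -
    have zw: "z \<in> W" "\<And>u. u \<in> W \<Longrightarrow> z \<circ> u = u \<circ> z" "w \<in> W" "\<And>u. u \<in> W \<Longrightarrow> w \<circ> u = u \<circ> w"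
      using that by (auto simp: Z_def)
    have "z \<circ> w \<circ> u = u \<circ> (z \<circ> w)" if u: "u \<in> W" for u
    proof -
      have "z \<circ> w \<circ> u = z \<circ> (w \<circ> u)" by (simp only: comp_assoc)
      also have "\<dots> = z \<circ> u \<circ> w" by (simp only: zw(4)[OF u] comp_assoc)
      also have "\<dots> = u \<circ> (z \<circ> w)" by (simp only: zw(2)[OF u] comp_assoc)
      finally show ?thesis .
    qed
    then show ?thesis using W_comp[OF zw(1,3)] unfolding Z_def by blast
  qed
  have Z_comm: "z \<circ> x = x \<circ> z" if "z \<in> Z" "x \<in> Z \<union> {L a, L b, L c, L ?r, D a b, D b c, D c a}" for z x
  proof -
    have "x \<in> W" using that(2) W_elems unfolding Z_def by blast
    then show ?thesis using that(1) unfolding Z_def by blast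
  qed
  have Z_one: "id \<in> Z" using subgroup.one_closed[OF W] by (simp add: Z_def)
  have ZG: "z \<in> carrier G" if "z \<in> Z" for z using that WG by (simp add: Z_def)
  have rB: "?r \<in> B" using abc by simp
  show ?thesis
  proof (rule G.three_generated_3_group[OF finite_G, where Q = "L ?r" and F = "D a b" and H = "D b c" and K = "D c a"
        and Z = Z and zA = "D ?r a" and zB = "D ?r b" and zC = "D ?r c" and zFH = zFH and zFK = zFK and zHK = zHK
        and kF = kF and kH = kH and kK = kK])
    show "x [^]\<^bsub>G\<^esub> (3::nat) = \<one>\<^bsub>G\<^esub>" if "x \<in> {L a, L b, L c, L ?r, D a b, D b c, D c a}" for x
      using that L_cube D_cube abc by auto
    show "z \<otimes>\<^bsub>G\<^esub> w \<in> Z" if "z \<in> Z" "w \<in> Z" for z w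
      using Z_comp[OF that] by simp
    show "z \<otimes>\<^bsub>G\<^esub> x = x \<otimes>\<^bsub>G\<^esub> z" if "z \<in> Z" "x \<in> Z \<union> {L a, L b, L c, L ?r, D a b, D b c, D c a}" for z x
      using Z_comm[OF that] by simp
    show "\<one>\<^bsub>G\<^esub> \<in> Z" using Z_one by simp
    show "inv\<^bsub>G\<^esub> z \<in> Z" if "z \<in> Z" for z using Z_inv[OF that] .
    show "z \<in> carrier G" if "z \<in> Z" for z using ZG[OF that] .
    show "D ?r a \<in> Z" "D ?r b \<in> Z" "D ?r c \<in> Z" using D_Z by blast+
    show "zFH \<in> Z" "zFK \<in> Z" "zHK \<in> Z" "kF \<in> Z" "kH \<in> Z" "kK \<in> Z"
      using zFH(1) zFK(1) zHK(1) kF(1) kH(1) kK(1) by auto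
    show "D b c \<otimes>\<^bsub>G\<^esub> D a b = zFH \<otimes>\<^bsub>G\<^esub> D a b \<otimes>\<^bsub>G\<^esub> D b c"
      "D c a \<otimes>\<^bsub>G\<^esub> D a b = zFK \<otimes>\<^bsub>G\<^esub> D a b \<otimes>\<^bsub>G\<^esub> D c a"
      "D c a \<otimes>\<^bsub>G\<^esub> D b c = zHK \<otimes>\<^bsub>G\<^esub> D b c \<otimes>\<^bsub>G\<^esub> D c a"
      "D a b \<otimes>\<^bsub>G\<^esub> L c = kF \<otimes>\<^bsub>G\<^esub> L ?r \<otimes>\<^bsub>G\<^esub> L c \<otimes>\<^bsub>G\<^esub> D a b"
      "D b c \<otimes>\<^bsub>G\<^esub> L a = kH \<otimes>\<^bsub>G\<^esub> L ?r \<otimes>\<^bsub>G\<^esub> L a \<otimes>\<^bsub>G\<^esub> D b c"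
      "D c a \<otimes>\<^bsub>G\<^esub> L b = kK \<otimes>\<^bsub>G\<^esub> L ?r \<otimes>\<^bsub>G\<^esub> L b \<otimes>\<^bsub>G\<^esub> D c a"
      using zFH(2) zFK(2) zHK(2) kF(2) kH(2) kK(2) by (simp_all only: quasigroup_auts_simps)
    show "L a \<otimes>\<^bsub>G\<^esub> L b = D a b \<otimes>\<^bsub>G\<^esub> L b \<otimes>\<^bsub>G\<^esub> L a"
      "L b \<otimes>\<^bsub>G\<^esub> L c = D b c \<otimes>\<^bsub>G\<^esub> L c \<otimes>\<^bsub>G\<^esub> L b"
      "L c \<otimes>\<^bsub>G\<^esub> L a = D c a \<otimes>\<^bsub>G\<^esub> L a \<otimes>\<^bsub>G\<^esub> L c"
      "L ?r \<otimes>\<^bsub>G\<^esub> L a = D ?r a \<otimes>\<^bsub>G\<^esub> L a \<otimes>\<^bsub>G\<^esub> L ?r"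
      "L ?r \<otimes>\<^bsub>G\<^esub> L b = D ?r b \<otimes>\<^bsub>G\<^esub> L b \<otimes>\<^bsub>G\<^esub> L ?r"
      "L ?r \<otimes>\<^bsub>G\<^esub> L c = D ?r c \<otimes>\<^bsub>G\<^esub> L c \<otimes>\<^bsub>G\<^esub> L ?r"
      unfolding quasigroup_auts_simps using abc rB by (blast intro: L_swap)+
    show "D a b \<otimes>\<^bsub>G\<^esub> L a = L a \<otimes>\<^bsub>G\<^esub> D a b" "D a b \<otimes>\<^bsub>G\<^esub> L b = L b \<otimes>\<^bsub>G\<^esub> D a b"
      "D a b \<otimes>\<^bsub>G\<^esub> L ?r = L ?r \<otimes>\<^bsub>G\<^esub> D a b"
      "D b c \<otimes>\<^bsub>G\<^esub> L b = L b \<otimes>\<^bsub>G\<^esub> D b c" "D b c \<otimes>\<^bsub>G\<^esub> L c = L c \<otimes>\<^bsub>G\<^esub> D b c"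
      "D b c \<otimes>\<^bsub>G\<^esub> L ?r = L ?r \<otimes>\<^bsub>G\<^esub> D b c"
      "D c a \<otimes>\<^bsub>G\<^esub> L c = L c \<otimes>\<^bsub>G\<^esub> D c a" "D c a \<otimes>\<^bsub>G\<^esub> L a = L a \<otimes>\<^bsub>G\<^esub> D c a"
      "D c a \<otimes>\<^bsub>G\<^esub> L ?r = L ?r \<otimes>\<^bsub>G\<^esub> D c a"
      unfolding quasigroup_auts_simps using abc rB rf by (simp_all add: comm_DL)
  qed (use abc in simp_all)
qed

end

lemma quasigroup_auts_cong:
  assumes "\<And>x y. x \<in> B \<Longrightarrow> y \<in> B \<Longrightarrow> s x y = t x y" and "\<And>x y. x \<in> B \<Longrightarrow> y \<in> B \<Longrightarrow> s x y \<in> B"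
  shows "quasigroup_auts B s = quasigroup_auts B t"
proof -
  have "(\<forall>x\<in>B. \<forall>y\<in>B. g (s x y) = s (g x) (g y)) \<longleftrightarrow> (\<forall>x\<in>B. \<forall>y\<in>B. g (t x y) = t (g x) (g y))"
    if "g permutes B" for g
    using that assms by (simp add: permutes_in_image)
  then show ?thesis unfolding quasigroup_auts_def by (auto intro!: Collect_cong)
qed

section \<open>Change of unit and the order of the loop\<close>

context exp3_cml
begin

lemma s_comm: "x \<in> B \<Longrightarrow> y \<in> B \<Longrightarrow> s x y = s y x" by (simp add: s_def comm)

lemma s_idem [simp]: "x \<in> B \<Longrightarrow> s x x = x" by (simp add: s_def)

lemma s_distrib: assumes "x \<in> B" "u \<in> B" "v \<in> B" shows "s x (s u v) = s (s x u) (s x v)"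
  using assms by (simp add: s_def i_hom cml_i)

text \<open>In the distributive quasigroup no point is distinguished: any o' serves as unit of a
  loop with the same third-point operation on B, hence with the same group \<open>G\<close>. The
  laws reduce to distributivity of \<open>s\<close>.\<close>

lemma exp3_cml_base: assumes "o' \<in> B" shows "exp3_cml B (\<lambda>x y. s o' (s x y)) o'"
proof
  fix x y z assume xyz: "x \<in> B" "y \<in> B" "z \<in> B"
  show "s o' (s (s o' (s x x)) (s o' (s y z))) = s o' (s (s o' (s x y)) (s o' (s x z)))"
    using xyz assms by (simp flip: s_distrib)
next
  fix x z assume xz: "x \<in> B" "z \<in> B"
  show "s o' (s (s o' (s x x)) (s o' (s x z))) = z"
    using xz assms by (simp flip: s_distrib)
next
  fix x y assume "x \<in> B" "y \<in> B"
  then show "s o' (s x y) = s o' (s y x)" by (simp only: s_comm[of x y])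
qed (use fin assms in simp_all)

lemma \<sigma>_\<sigma> [simp]: "\<sigma> x \<circ> \<sigma> x = id" if "x \<in> B"
  using that by (intro quasigroup_auts_eqI[of _ B s]) (auto simp: G.one_closed[simplified])

text \<open>In the loop with unit o' the left translation by x is \<open>\<sigma> o'\<close> after
  \<open>\<sigma> x\<close>. Since each \<open>\<sigma>\<close> is an involution,
  \<open>\<sigma> a \<circ> \<sigma> b\<close> is the inverse translation by a after that by b, and
  \<open>\<sigma> c \<circ> \<sigma> o'\<close> is the inverse translation by c.\<close>

lemma p_subgroup_four_points:
  assumes abcd: "a \<in> B" "b \<in> B" "c \<in> B" "o' \<in> B"
  shows "p_subgroup 3 G (generate G {\<sigma> a \<circ> \<sigma> b, \<sigma> c \<circ> \<sigma> o'})"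
proof -
  interpret O: exp3_cml B "\<lambda>x y. s o' (s x y)" o' using exp3_cml_base[OF abcd(4)] .
  have "O.s x y = s x y" if "x \<in> B" "y \<in> B" for x y
    using that abcd by (simp add: O.s_def O.i_def)
  then have G: "quasigroup_auts B O.s = G" by (intro quasigroup_auts_cong) auto
  have L: "O.L x = \<sigma> o' \<circ> \<sigma> x" if "x \<in> B" for x
    using that by (auto simp: O.L_def \<sigma>_def fun_eq_iff)
  let ?L = "\<lambda>x. \<sigma> o' \<circ> \<sigma> x"
  let ?H = "generate G {?L a, ?L b, ?L c}"
  have p: "p_subgroup 3 G ?H"
    using O.L_generate_3_group[OF abcd(1-3)] abcd by (simp add: G L)
  then have H: "subgroup ?H G" by (simp add: p_subgroup_def)
  have inv_L: "inv\<^bsub>G\<^esub> (?L x) = \<sigma> x \<circ> \<sigma> o'" if "x \<in> B" for x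
  proof (rule G.inv_equality)
    have "\<sigma> x \<circ> \<sigma> o' \<circ> (\<sigma> o' \<circ> \<sigma> x) = \<sigma> x \<circ> (\<sigma> o' \<circ> \<sigma> o') \<circ> \<sigma> x" by (simp only: comp_assoc)
    then show "(\<sigma> x \<circ> \<sigma> o') \<otimes>\<^bsub>G\<^esub> ?L x = \<one>\<^bsub>G\<^esub>" using that abcd by simp
  qed (use that abcd in simp_all)
  have gens: "?L a \<in> ?H" "?L b \<in> ?H" "?L c \<in> ?H" by (auto intro: generate.incl)
  have "\<sigma> c \<circ> \<sigma> o' \<in> ?H" using subgroup.m_inv_closed[OF H gens(3)] inv_L[of c] abcd by simp
  moreover have "\<sigma> a \<circ> \<sigma> b \<in> ?H"
  proof -
    have "(\<sigma> a \<circ> \<sigma> o') \<otimes>\<^bsub>G\<^esub> ?L b \<in> ?H"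
      using subgroup.m_closed[OF H subgroup.m_inv_closed[OF H gens(1)] gens(2)] inv_L[of a] abcd by simp
    moreover have "(\<sigma> a \<circ> \<sigma> o') \<otimes>\<^bsub>G\<^esub> ?L b = \<sigma> a \<circ> (\<sigma> o' \<circ> \<sigma> o') \<circ> \<sigma> b"
      by (simp only: comp_assoc quasigroup_auts_simps)
    moreover have "\<dots> = \<sigma> a \<circ> \<sigma> b" using abcd by (simp only: \<sigma>_\<sigma> comp_id)
    ultimately show ?thesis by (simp only:)
  qed
  ultimately have "generate G {\<sigma> a \<circ> \<sigma> b, \<sigma> c \<circ> \<sigma> o'} \<subseteq> ?H"
    using H by (intro G.generate_subgroup_incl) auto
  then show ?thesis
    using abcd by (intro G.p_subgroup_subset[OF p] G.generate_is_subgroup) auto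
qed

theorem card_power_of_3: "\<exists>n. card B = 3 ^ n"
proof -
  let ?C = "{\<sigma> x \<circ> \<sigma> y | x y. x \<in> B \<and> y \<in> B}"
  let ?P = "generate G ?C"
  have CG: "?C \<subseteq> carrier G" by auto
  have p: "p_subgroup 3 G ?P"
  proof (rule G.baer_suzuki[OF finite_G _ CG])
    show "prime (3::nat)" by simp
    fix g h assume g: "g \<in> ?C" and h: "h \<in> ?C"
    then obtain x y where xy: "h = \<sigma> x \<circ> \<sigma> y" "x \<in> B" "y \<in> B" by blast
    have gG: "g \<in> carrier G" using g CG by blast
    have "g \<circ> h = \<sigma> (g x) \<circ> \<sigma> (g y) \<circ> g"
      using \<sigma>_conj[OF gG xy(2)] \<sigma>_conj[OF gG xy(3)] unfolding xy(1) by (metis comp_assoc)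
    then have "g \<otimes>\<^bsub>G\<^esub> h \<otimes>\<^bsub>G\<^esub> inv\<^bsub>G\<^esub> g = (\<sigma> (g x) \<circ> \<sigma> (g y)) \<otimes>\<^bsub>G\<^esub> (g \<otimes>\<^bsub>G\<^esub> inv\<^bsub>G\<^esub> g)"
      by (simp add: comp_assoc)
    then have "g \<otimes>\<^bsub>G\<^esub> h \<otimes>\<^bsub>G\<^esub> inv\<^bsub>G\<^esub> g = \<sigma> (g x) \<circ> \<sigma> (g y)"
      using G.r_inv[OF gG] by simp
    moreover have "g x \<in> B" "g y \<in> B" using gG xy by simp_all
    ultimately show "g \<otimes>\<^bsub>G\<^esub> h \<otimes>\<^bsub>G\<^esub> inv\<^bsub>G\<^esub> g \<in> ?C" by blast
  next
    fix g h assume "g \<in> ?C" "h \<in> ?C"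
    then show "p_subgroup 3 G (generate G {g, h})" using p_subgroup_four_points by blast
  qed
  obtain n where n: "card ?P = 3 ^ n" using G.card_p_subgroup[OF finite_G _ p] by auto
  have "group_action G B (\<lambda>g. restrict g B)"
    unfolding group_action_def
  proof (intro group_hom.intro group_hom_axioms.intro)
    show "group G" by (rule G.group_axioms)
    show "group (BijGroup B)" by (rule group_BijGroup)
    have bij: "restrict g B \<in> Bij B" if "g \<in> carrier G" for g
      using that by (auto simp: Bij_def mem_quasigroup_auts permutes_imp_bij)
    show "(\<lambda>g. restrict g B) \<in> hom G (BijGroup B)"
    proof (rule homI)
      show "restrict g B \<in> carrier (BijGroup B)" if "g \<in> carrier G" for g
        using bij[OF that] by (simp add: BijGroup_def)
      show "restrict (g \<otimes>\<^bsub>G\<^esub> h) B = restrict g B \<otimes>\<^bsub>BijGroup B\<^esub> restrict h B"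
        if "g \<in> carrier G" "h \<in> carrier G" for g h
        using bij[OF that(1)] bij[OF that(2)] that
        by (auto simp: BijGroup_def compose_def restrict_def fun_eq_iff)
    qed
  qed
  then interpret act: group_action "G\<lparr>carrier := ?P\<rparr>" B "\<lambda>g. restrict g B"
    by (rule group_action.induced_action) (rule G.generate_is_subgroup[OF CG])
  have "orbit (G\<lparr>carrier := ?P\<rparr>) (\<lambda>g. restrict g B) e = B"
  proof
    show "orbit (G\<lparr>carrier := ?P\<rparr>) (\<lambda>g. restrict g B) e \<subseteq> B"
      using G.generate_incl[OF CG] by (auto simp: orbit_def)
    show "B \<subseteq> orbit (G\<lparr>carrier := ?P\<rparr>) (\<lambda>g. restrict g B) e"
    proof
      fix v assume v: "v \<in> B"
      \<comment> \<open>Transitivity: \<open>\<sigma> e\<close> fixes e, and the reflection in the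
        third point on the line through e and v takes e to v.\<close>
      have "s e v \<in> B" using v by simp
      then have "\<sigma> (s e v) \<circ> \<sigma> e \<in> ?C" using e_in by blast
      then have "\<sigma> (s e v) \<circ> \<sigma> e \<in> ?P" by (rule generate.incl)
      moreover have "(\<sigma> (s e v) \<circ> \<sigma> e) e = v" using v by (simp add: s_comm[of "s e v" e])
      ultimately show "v \<in> orbit (G\<lparr>carrier := ?P\<rparr>) (\<lambda>g. restrict g B) e"
        unfolding orbit_def by (auto intro!: exI[of _ "\<sigma> (s e v) \<circ> \<sigma> e"])
    qed
  qed
  then show ?thesis
    using act.card_orbit_prime_power[of 3 n e] n by (simp add: order_def)
qed

end

section \<open>Lagrange's theorem\<close>

lemma card_eq_fiber_mult_image:
  assumes "finite A" and "\<And>a. a \<in> A \<Longrightarrow> card {x \<in> A. f x = f a} = k"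
  shows "card A = k * card (f ` A)"
proof -
  have "card A = (\<Sum>y\<in>f ` A. card {x \<in> A. f x = y})"
    unfolding card_eq_sum by (rule sum.image_gen[OF assms(1)])
  also have "\<dots> = (\<Sum>y\<in>f ` A. k)" using assms(2) by (intro sum.cong) auto
  finally show ?thesis by simp
qed

text \<open>In a finite cancellative monoid every translation is onto, also within a submonoid, so
  inverses exist and this is Lagrange's theorem for groups.\<close>

lemma card_submonoid_dvd:
  assumes fin: "finite N" and closed: "\<And>x y. x \<in> N \<Longrightarrow> y \<in> N \<Longrightarrow> m x y \<in> N"
    and assoc: "\<And>x y z. x \<in> N \<Longrightarrow> y \<in> N \<Longrightarrow> z \<in> N \<Longrightarrow> m (m x y) z = m x (m y z)"
    and e: "\<And>x. x \<in> N \<Longrightarrow> m e x = x" "\<And>x. x \<in> N \<Longrightarrow> m x e = x"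
    and cancel: "\<And>x y z. x \<in> N \<Longrightarrow> y \<in> N \<Longrightarrow> z \<in> N \<Longrightarrow> m x y = m x z \<Longrightarrow> y = z"
    and M: "M \<subseteq> N" "e \<in> M" "\<And>x y. x \<in> M \<Longrightarrow> y \<in> M \<Longrightarrow> m x y \<in> M"
  shows "card M dvd card N"
proof -
  let ?G = "\<lparr>carrier = N, monoid.mult = m, one = e\<rparr>"
  have right_inv: "\<exists>y\<in>A. m x y = e" if A: "A \<subseteq> N" "e \<in> A" "\<And>x y. x \<in> A \<Longrightarrow> y \<in> A \<Longrightarrow> m x y \<in> A" "x \<in> A" for A x
  proof -
    have "inj_on (m x) A" using cancel A by (meson inj_onI subsetD)
    moreover have "m x ` A \<subseteq> A" using A by blast
    ultimately have "m x ` A = A" using A(1) fin by (meson endo_inj_surj finite_subset)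
    then show ?thesis using A(2) by (metis imageE)
  qed
  have left_inv: "\<exists>y\<in>A. m y x = e" if A: "A \<subseteq> N" "e \<in> A" "\<And>x y. x \<in> A \<Longrightarrow> y \<in> A \<Longrightarrow> m x y \<in> A" "x \<in> A" for A x
  proof -
    obtain y where y: "y \<in> A" "m x y = e" using right_inv[OF A] by blast
    obtain z where z: "z \<in> A" "m y z = e" using right_inv[OF A(1-3) y(1)] by blast
    have N: "x \<in> N" "y \<in> N" "z \<in> N" using A(1,4) y z by auto
    have "x = m (m x y) z" using assoc[OF N] z(2) e(2)[OF N(1)] by simp
    then have "x = z" using y(2) e(1)[OF N(3)] by simp
    then show ?thesis using y z by blast
  qed
  have eN: "e \<in> N" using M by blast
  have "group ?G"
  proof (rule groupI)
    show "\<exists>y\<in>carrier ?G. y \<otimes>\<^bsub>?G\<^esub> x = \<one>\<^bsub>?G\<^esub>" if "x \<in> carrier ?G" for x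
      using left_inv[of N x] closed eN that by simp
  qed (use closed assoc e eN in simp_all)
  then interpret G: group ?G .
  have "subgroup M ?G"
  proof (rule G.subgroupI)
    show "inv\<^bsub>?G\<^esub> x \<in> M" if x: "x \<in> M" for x
    proof -
      obtain y where y: "y \<in> M" "m y x = e" using left_inv[OF M x] by blast
      then have "inv\<^bsub>?G\<^esub> x = y" using x M(1) by (intro G.inv_equality) auto
      then show ?thesis using y by simp
    qed
  qed (use M in auto)
  then have "card (rcosets\<^bsub>?G\<^esub> M) * card M = order ?G" by (rule G.lagrange)
  then have "card N = card (rcosets\<^bsub>?G\<^esub> M) * card M" by (simp add: order_def)
  then show ?thesis by (rule dvdI[of _ _ "card (rcosets\<^bsub>?G\<^esub> M)", OF trans[OF _ mult.commute]])
qed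

section \<open>Inverses in finite Moufang loops\<close>

locale finite_moufang =
  fixes Q :: "'a set" and m :: "'a \<Rightarrow> 'a \<Rightarrow> 'a" (infixl "\<cdot>" 70) and e :: 'a
  assumes finite_Q: "finite Q" and e_in [simp]: "e \<in> Q"
    and closed [simp]: "x \<in> Q \<Longrightarrow> y \<in> Q \<Longrightarrow> x \<cdot> y \<in> Q"
    and unit_l [simp]: "x \<in> Q \<Longrightarrow> e \<cdot> x = x" and unit_r [simp]: "x \<in> Q \<Longrightarrow> x \<cdot> e = x"
    and moufang: "x \<in> Q \<Longrightarrow> y \<in> Q \<Longrightarrow> z \<in> Q \<Longrightarrow> ((x \<cdot> y) \<cdot> x) \<cdot> z = x \<cdot> (y \<cdot> (x \<cdot> z))"
    and left_cancel: "x \<in> Q \<Longrightarrow> y \<in> Q \<Longrightarrow> z \<in> Q \<Longrightarrow> x \<cdot> y = x \<cdot> z \<Longrightarrow> y = z"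
begin

lemma finite_moufang_sub:
  assumes "T \<subseteq> Q" "e \<in> T" "\<And>x y. x \<in> T \<Longrightarrow> y \<in> T \<Longrightarrow> x \<cdot> y \<in> T"
  shows "finite_moufang T m e"
proof
  show "finite T" using assms(1) finite_Q finite_subset by blast
  show "((x \<cdot> y) \<cdot> x) \<cdot> z = x \<cdot> (y \<cdot> (x \<cdot> z))" if "x \<in> T" "y \<in> T" "z \<in> T" for x y z
    using that assms(1) by (intro moufang) auto
  show "y = z" if "x \<in> T" "y \<in> T" "z \<in> T" "x \<cdot> y = x \<cdot> z" for x y z
    using left_cancel[of x y z] that assms(1) by auto
  show "e \<cdot> x = x" "x \<cdot> e = x" if "x \<in> T" for x using that assms(1) by auto
qed (use assms(2,3) in auto)

lemma left_solvable:
  assumes "T \<subseteq> Q" "\<And>x y. x \<in> T \<Longrightarrow> y \<in> T \<Longrightarrow> x \<cdot> y \<in> T" "x \<in> T" "z \<in> T"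
  shows "\<exists>y\<in>T. x \<cdot> y = z"
proof -
  have "inj_on (m x) T" using left_cancel assms by (meson inj_onI subsetD)
  moreover have "m x ` T \<subseteq> T" using assms by blast
  ultimately have "m x ` T = T" using assms(1) finite_Q by (meson endo_inj_surj finite_subset)
  then show ?thesis using assms(4) by (metis imageE)
qed

definition i where "i x = (THE y. y \<in> Q \<and> x \<cdot> y = e)"

lemma i_eqI: "x \<in> Q \<Longrightarrow> y \<in> Q \<Longrightarrow> x \<cdot> y = e \<Longrightarrow> i x = y"
  unfolding i_def using left_cancel by (intro the_equality) (blast, metis)

lemma i_sub:
  assumes "T \<subseteq> Q" "e \<in> T" "\<And>x y. x \<in> T \<Longrightarrow> y \<in> T \<Longrightarrow> x \<cdot> y \<in> T" "x \<in> T"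
  shows "i x \<in> T"
proof -
  obtain y where y: "y \<in> T" "x \<cdot> y = e" using left_solvable[of T x e] assms by blast
  then have "i x = y" using assms(1,4) by (intro i_eqI) auto
  then show ?thesis using y by simp
qed

lemma i_in [simp]: "x \<in> Q \<Longrightarrow> i x \<in> Q" using i_sub[of Q x] by simp

lemma i_right [simp]: "x \<in> Q \<Longrightarrow> x \<cdot> i x = e"
  using left_solvable[of Q x e] i_eqI by auto

lemma sq_mult: "x \<in> Q \<Longrightarrow> z \<in> Q \<Longrightarrow> (x \<cdot> x) \<cdot> z = x \<cdot> (x \<cdot> z)"
  using moufang[of x e z] by simp

lemma flexible: "x \<in> Q \<Longrightarrow> y \<in> Q \<Longrightarrow> (x \<cdot> y) \<cdot> x = x \<cdot> (y \<cdot> x)"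
  using moufang[of x y e] by simp

lemma i_cancel [simp]: "x \<in> Q \<Longrightarrow> z \<in> Q \<Longrightarrow> i x \<cdot> (x \<cdot> z) = z"
  using moufang[of x "i x" z] left_cancel[of x "i x \<cdot> (x \<cdot> z)" z] by simp

lemma i_left [simp]: "x \<in> Q \<Longrightarrow> i x \<cdot> x = e"
  using i_cancel[of x e] by simp

lemma i_i [simp]: "x \<in> Q \<Longrightarrow> i (i x) = x" by (rule i_eqI) simp_all

lemma cancel_i [simp]: "x \<in> Q \<Longrightarrow> z \<in> Q \<Longrightarrow> x \<cdot> (i x \<cdot> z) = z"
  using i_cancel[of "i x" z] by simp

lemma mult_i_cancel [simp]: assumes "x \<in> Q" "w \<in> Q" shows "(w \<cdot> x) \<cdot> i x = w"
proof -
  have "((x \<cdot> (i x \<cdot> w)) \<cdot> x) \<cdot> i x = x \<cdot> (i x \<cdot> w)"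
    using assms moufang[of x "i x \<cdot> w" "i x"] by simp
  then show ?thesis using assms by simp
qed

lemma mult_cancel_i [simp]: "x \<in> Q \<Longrightarrow> w \<in> Q \<Longrightarrow> (w \<cdot> i x) \<cdot> x = w"
  using mult_i_cancel[of "i x" w] by simp

lemma i_mult: assumes "x \<in> Q" "y \<in> Q" shows "i (x \<cdot> y) = i y \<cdot> i x"
proof -
  have "i (x \<cdot> y) \<cdot> x = i y"
    using i_cancel[of "x \<cdot> y" "i y"] assms by simp
  then have "i y \<cdot> i x = (i (x \<cdot> y) \<cdot> x) \<cdot> i x" by simp
  then show ?thesis using assms by simp
qed

lemma cancel_iff: "x \<in> Q \<Longrightarrow> y \<in> Q \<Longrightarrow> z \<in> Q \<Longrightarrow> x \<cdot> y = x \<cdot> z \<longleftrightarrow> y = z"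
  using left_cancel by blast

lemma moufang_split: "x \<in> Q \<Longrightarrow> a \<in> Q \<Longrightarrow> b \<in> Q \<Longrightarrow> ((x \<cdot> a) \<cdot> x) \<cdot> (i x \<cdot> b) = x \<cdot> (a \<cdot> b)"
  using moufang[of x a "i x \<cdot> b"] by simp

end

section \<open>Cubing in commutative Moufang loops\<close>

locale finite_cml = finite_moufang +
  assumes comm: "x \<in> Q \<Longrightarrow> y \<in> Q \<Longrightarrow> x \<cdot> y = y \<cdot> x"
begin

lemma finite_cml_sub:
  assumes "T \<subseteq> Q" "e \<in> T" "\<And>x y. x \<in> T \<Longrightarrow> y \<in> T \<Longrightarrow> x \<cdot> y \<in> T"
  shows "finite_cml T m e"
  using finite_moufang_sub[OF assms] comm assms(1)
  by (auto simp: finite_cml_def finite_cml_axioms_def subset_iff)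

lemma split_left: "x \<in> Q \<Longrightarrow> a \<in> Q \<Longrightarrow> b \<in> Q \<Longrightarrow> (x \<cdot> (x \<cdot> a)) \<cdot> (i x \<cdot> b) = x \<cdot> (a \<cdot> b)"
  using moufang_split[of x a b] comm[of "x \<cdot> a" x] by simp

lemma split_right: "x \<in> Q \<Longrightarrow> a \<in> Q \<Longrightarrow> b \<in> Q \<Longrightarrow> (i x \<cdot> a) \<cdot> (x \<cdot> (x \<cdot> b)) = x \<cdot> (a \<cdot> b)"
  using split_left[of x b a] comm[of a b] comm[of "i x \<cdot> a" "x \<cdot> (x \<cdot> b)"] by simp

text \<open>The two splittings of a translation by x, applied one after the other, cancel their
  surplus factors: each side keeps a single x.\<close>

lemma cml: assumes "x \<in> Q" "a \<in> Q" "b \<in> Q" shows "(x \<cdot> a) \<cdot> (x \<cdot> b) = x \<cdot> (x \<cdot> (a \<cdot> b))"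
proof -
  have "x \<cdot> (x \<cdot> (a \<cdot> b)) = x \<cdot> ((i x \<cdot> a) \<cdot> (x \<cdot> (x \<cdot> b)))" using assms by (simp add: split_right)
  also have "\<dots> = (x \<cdot> (x \<cdot> (i x \<cdot> a))) \<cdot> (i x \<cdot> (x \<cdot> (x \<cdot> b)))"
    by (rule split_left[symmetric]) (use assms in simp_all)
  finally show ?thesis using assms by simp
qed

definition cube where "cube x = x \<cdot> (x \<cdot> x)"

lemma cube_in [simp]: "x \<in> Q \<Longrightarrow> cube x \<in> Q" by (simp add: cube_def)

lemma cube_mult: "x \<in> Q \<Longrightarrow> b \<in> Q \<Longrightarrow> cube x \<cdot> b = x \<cdot> (x \<cdot> (x \<cdot> b))"
  using moufang[of x x b] flexible[of x x] by (simp add: cube_def)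

text \<open>\<open>split_left\<close> at \<open>x a\<close> and \<open>x b\<close> has three factors
  x on a and none on b; on the right, \<open>cml\<close> collects three factors x in front of
  \<open>a b\<close>.\<close>

lemma cube_nuclear: assumes "x \<in> Q" "a \<in> Q" "b \<in> Q" shows "(cube x \<cdot> a) \<cdot> b = cube x \<cdot> (a \<cdot> b)"
  using split_left[of x "x \<cdot> a" "x \<cdot> b"] assms by (simp add: cube_mult cml)

lemma cube_hom: assumes "x \<in> Q" "y \<in> Q" shows "cube (x \<cdot> y) = cube x \<cdot> cube y"
proof -
  have "y \<cdot> (x \<cdot> (y \<cdot> y)) = ((y \<cdot> x) \<cdot> y) \<cdot> y" using assms by (simp add: moufang)
  also have "\<dots> = cube y \<cdot> x"
    using assms comm[of "y \<cdot> x" y] comm[of "y \<cdot> (y \<cdot> x)" y] by (simp add: cube_mult)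
  finally have y: "y \<cdot> (x \<cdot> (y \<cdot> y)) = x \<cdot> cube y" using assms by (simp add: comm[of x])
  have "cube (x \<cdot> y) = (x \<cdot> y) \<cdot> (x \<cdot> (x \<cdot> (y \<cdot> y)))" using assms by (simp add: cube_def cml)
  also have "\<dots> = x \<cdot> (x \<cdot> (x \<cdot> cube y))" using assms y by (simp add: cml)
  finally show ?thesis using assms by (simp add: cube_mult)
qed

definition B where "B = {x \<in> Q. cube x = e}"

lemma cube_e [simp]: "cube e = e" by (simp add: cube_def)

lemma exp3_cml_B: "exp3_cml B m e"
proof
  show "finite B" unfolding B_def using finite_Q by simp
  show "x \<cdot> y \<in> B" if "x \<in> B" "y \<in> B" for x y using that by (simp add: B_def cube_hom)
  show "(x \<cdot> x) \<cdot> (y \<cdot> z) = (x \<cdot> y) \<cdot> (x \<cdot> z)" if "x \<in> B" "y \<in> B" "z \<in> B" for x y z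
    using that by (simp add: B_def cml sq_mult)
  show "(x \<cdot> x) \<cdot> (x \<cdot> z) = z" if "x \<in> B" "z \<in> B" for x z
    using that cube_mult[of x z] by (simp add: B_def sq_mult)
  show "x \<cdot> y = y \<cdot> x" if "x \<in> B" "y \<in> B" for x y using that comm by (simp add: B_def)
qed (simp_all add: B_def)

text \<open>The fibres of cubing are the translates of its kernel \<open>B\<close>, so for this
  subloop the cosets cannot overlap partially.\<close>

lemma card_cubes: "card Q = card B * card (cube ` Q)"
proof (rule card_eq_fiber_mult_image[OF finite_Q])
  fix a assume a: "a \<in> Q"
  have "{x \<in> Q. cube x = cube a} = m a ` B"
  proof
    show "m a ` B \<subseteq> {x \<in> Q. cube x = cube a}"
    proof
      fix x assume "x \<in> m a ` B"
      then obtain b where "b \<in> Q" "cube b = e" "x = a \<cdot> b" by (auto simp: B_def)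
      then show "x \<in> {x \<in> Q. cube x = cube a}" using a by (simp add: cube_hom)
    qed
    show "{x \<in> Q. cube x = cube a} \<subseteq> m a ` B"
    proof
      fix x assume x: "x \<in> {x \<in> Q. cube x = cube a}"
      have "cube a \<cdot> cube (i a \<cdot> x) = cube (a \<cdot> (i a \<cdot> x))"
        using a x by (intro cube_hom[symmetric]) simp_all
      then have "cube a \<cdot> cube (i a \<cdot> x) = cube a \<cdot> e" using a x by simp
      then have "i a \<cdot> x \<in> B" using a x left_cancel[of "cube a" _ e] by (simp add: B_def)
      then show "x \<in> m a ` B" using a x by (intro image_eqI[of _ _ "i a \<cdot> x"]) simp_all
    qed
  qed
  moreover have "inj_on (m a) B" using a left_cancel by (intro inj_onI) (auto simp: B_def)
  ultimately show "card {x \<in> Q. cube x = cube a} = card B" by (simp add: card_image)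
qed

theorem card_sub_dvd:
  assumes T: "T \<subseteq> Q" "e \<in> T" "\<And>x y. x \<in> T \<Longrightarrow> y \<in> T \<Longrightarrow> x \<cdot> y \<in> T"
  shows "card T dvd card Q"
proof -
  interpret T: finite_cml T m e using finite_cml_sub[OF T] .
  obtain k n where k: "card T.B = 3 ^ k" and n: "card B = 3 ^ n"
    using exp3_cml.card_power_of_3 exp3_cml_B T.exp3_cml_B by metis
  \<comment> \<open>The factor that is not a group is compared by size alone: of two powers of 3 the
    smaller divides the larger.\<close>
  have "T.B \<subseteq> B" using T(1) by (auto simp: T.B_def B_def)
  then have "card T.B \<le> card B" using finite_Q by (intro card_mono) (simp_all add: B_def)
  then have "k \<le> n" using k n by simp
  then have "card T.B dvd card B" using k n by (simp add: le_imp_power_dvd)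
  moreover have "card (cube ` T) dvd card (cube ` Q)"
  proof (rule card_submonoid_dvd[where m = m and e = e])
    show "finite (cube ` Q)" using finite_Q by simp
    show "cube ` T \<subseteq> cube ` Q" using T(1) by blast
    show "e \<in> cube ` T" using T(2) by (metis cube_e imageI)
    show "x \<cdot> y \<in> cube ` Q" if "x \<in> cube ` Q" "y \<in> cube ` Q" for x y
      using that by (auto simp flip: cube_hom)
    show "x \<cdot> y \<in> cube ` T" if "x \<in> cube ` T" "y \<in> cube ` T" for x y
      using that T(1,3) by (auto simp: subset_iff simp flip: cube_hom)
    show "(x \<cdot> y) \<cdot> z = x \<cdot> (y \<cdot> z)" if "x \<in> cube ` Q" "y \<in> cube ` Q" "z \<in> cube ` Q" for x y z
      using that by (auto simp: cube_nuclear)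
    show "y = z" if "x \<in> cube ` Q" "y \<in> cube ` Q" "z \<in> cube ` Q" "x \<cdot> y = x \<cdot> z" for x y z
      using that left_cancel[of x y z] by auto
  qed auto
  ultimately show ?thesis
    unfolding card_cubes T.card_cubes by (rule mult_dvd_mono)
qed

end

section \<open>The nucleus and the quotient by it\<close>

context finite_moufang
begin

text \<open>Only the middle nucleus is written down; in a Moufang loop it also associates from the
  left and right, as \<open>nucleus_left\<close> and \<open>nucleus_right\<close> show.\<close>

definition nucleus where "nucleus = {n \<in> Q. \<forall>a\<in>Q. \<forall>b\<in>Q. (a \<cdot> n) \<cdot> b = a \<cdot> (n \<cdot> b)}"

lemma nucleus_in [simp]: "n \<in> nucleus \<Longrightarrow> n \<in> Q" by (simp add: nucleus_def)

lemma nucleus_mid: "n \<in> nucleus \<Longrightarrow> a \<in> Q \<Longrightarrow> b \<in> Q \<Longrightarrow> (a \<cdot> n) \<cdot> b = a \<cdot> (n \<cdot> b)"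
  unfolding nucleus_def by blast

text \<open>With a written as \<open>?a n\<close>, the middle property and the Moufang identity
  rebracket \<open>n ((?a n) b)\<close> into \<open>(n (?a n)) b\<close>.\<close>

lemma nucleus_left: assumes n: "n \<in> nucleus" and ab: "a \<in> Q" "b \<in> Q" shows "(n \<cdot> a) \<cdot> b = n \<cdot> (a \<cdot> b)"
proof -
  let ?a = "a \<cdot> i n"
  have Q: "n \<in> Q" "?a \<in> Q" using n ab by simp_all
  have "n \<cdot> ((?a \<cdot> n) \<cdot> b) = n \<cdot> (?a \<cdot> (n \<cdot> b))" using nucleus_mid[OF n Q(2) ab(2)] by simp
  also have "\<dots> = (n \<cdot> (?a \<cdot> n)) \<cdot> b" using Q ab by (simp only: moufang[symmetric] flexible)
  finally show ?thesis using Q ab by simp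
qed

lemma nucleus_i: assumes n: "n \<in> nucleus" shows "i n \<in> nucleus"
proof -
  have "(x \<cdot> i n) \<cdot> y = x \<cdot> (i n \<cdot> y)" if "x \<in> Q" "y \<in> Q" for x y
    using nucleus_mid[OF n, of "x \<cdot> i n" "i n \<cdot> y"] n that by simp
  then show ?thesis using i_in[OF nucleus_in[OF n]] unfolding nucleus_def by blast
qed

lemma nucleus_right: assumes n: "n \<in> nucleus" and ab: "a \<in> Q" "b \<in> Q" shows "(a \<cdot> b) \<cdot> n = a \<cdot> (b \<cdot> n)"
proof -
  have "i ((i n \<cdot> i b) \<cdot> i a) = i (i n \<cdot> (i b \<cdot> i a))"
    using nucleus_left[OF nucleus_i[OF n]] ab by simp
  then show ?thesis using n ab by (simp add: i_mult)
qed

lemma nucleus_e: "e \<in> nucleus" unfolding nucleus_def by simp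

lemma nucleus_mult: assumes "n \<in> nucleus" "k \<in> nucleus" shows "n \<cdot> k \<in> nucleus"
proof -
  have "(a \<cdot> (n \<cdot> k)) \<cdot> b = a \<cdot> ((n \<cdot> k) \<cdot> b)" if "a \<in> Q" "b \<in> Q" for a b
  proof -
    have "(a \<cdot> (n \<cdot> k)) \<cdot> b = ((a \<cdot> n) \<cdot> k) \<cdot> b" using that assms by (simp add: nucleus_mid[of n])
    also have "\<dots> = (a \<cdot> n) \<cdot> (k \<cdot> b)" using that assms by (simp add: nucleus_mid[of k])
    also have "\<dots> = a \<cdot> (n \<cdot> (k \<cdot> b))" using that assms by (simp add: nucleus_mid[of n])
    also have "\<dots> = a \<cdot> ((n \<cdot> k) \<cdot> b)" using that assms by (simp add: nucleus_left[of n])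
    finally show ?thesis .
  qed
  moreover have "n \<cdot> k \<in> Q" using assms by simp
  ultimately show ?thesis unfolding nucleus_def by blast
qed

text \<open>The quotient by the nucleus is realised on a set of representatives of the cosets $x N$.\<close>

definition coset where "coset x = m x ` nucleus"
definition rep where "rep x = (SOME y. y \<in> coset x)"

lemma coset_self: "x \<in> Q \<Longrightarrow> x \<in> coset x"
  unfolding coset_def using nucleus_e by (intro image_eqI[of _ _ e]) simp_all

lemma coset_mult: assumes "x \<in> Q" "n \<in> nucleus" shows "coset (x \<cdot> n) = coset x"
proof
  have sub: "coset (y \<cdot> k) \<subseteq> coset y" if "y \<in> Q" "k \<in> nucleus" for y k
    unfolding coset_def using that by (auto simp: nucleus_mid intro!: nucleus_mult)
  show "coset (x \<cdot> n) \<subseteq> coset x" using sub assms by blast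
  have "coset ((x \<cdot> n) \<cdot> i n) \<subseteq> coset (x \<cdot> n)" using assms by (intro sub nucleus_i) simp_all
  then show "coset x \<subseteq> coset (x \<cdot> n)" using assms by simp
qed

lemma rep_mult: "x \<in> Q \<Longrightarrow> n \<in> nucleus \<Longrightarrow> rep (x \<cdot> n) = rep x"
  by (simp add: rep_def coset_mult)

lemma rep_in_coset: "x \<in> Q \<Longrightarrow> rep x \<in> coset x"
  unfolding rep_def using coset_self by (rule someI)

lemma repE: assumes "x \<in> Q" obtains n where "n \<in> nucleus" "rep x = x \<cdot> n"
  using rep_in_coset[OF assms] by (auto simp: coset_def)

lemma rep_in [simp]: "x \<in> Q \<Longrightarrow> rep x \<in> Q" using repE[of x] closed nucleus_in by metis

lemma rep_eqD: assumes "x \<in> Q" "y \<in> Q" "rep x = rep y" shows "\<exists>n\<in>nucleus. y = x \<cdot> n"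
proof -
  obtain n k where nk: "n \<in> nucleus" "k \<in> nucleus" "x \<cdot> n = y \<cdot> k"
    using assms by (metis repE)
  then have "y = (x \<cdot> n) \<cdot> i k" using assms by simp
  also have "\<dots> = x \<cdot> (n \<cdot> i k)" by (rule nucleus_mid) (use nk assms in simp_all)
  finally show ?thesis using nk nucleus_mult nucleus_i by blast
qed

end

locale nuclear_commutators = finite_moufang +
  assumes commutator: "x \<in> Q \<Longrightarrow> y \<in> Q \<Longrightarrow> \<exists>k\<in>nucleus. x \<cdot> y = (y \<cdot> x) \<cdot> k"
begin

text \<open>Normality of the nucleus, which makes multiplication of its cosets well defined in
  \<open>rep_hom\<close>: n and x commute up to a nuclear factor.\<close>

lemma nucleus_swap: assumes "n \<in> nucleus" "x \<in> Q" shows "\<exists>k\<in>nucleus. n \<cdot> x = x \<cdot> k"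
proof -
  obtain k where "k \<in> nucleus" "n \<cdot> x = (x \<cdot> n) \<cdot> k" using commutator[of n x] assms by auto
  then show ?thesis using assms by (intro bexI[of _ "n \<cdot> k"]) (simp_all add: nucleus_mid nucleus_mult)
qed

lemma rep_hom: assumes "x \<in> Q" "y \<in> Q" shows "rep (rep x \<cdot> rep y) = rep (x \<cdot> y)"
proof -
  obtain n where n: "n \<in> nucleus" "rep x = x \<cdot> n" using repE assms by metis
  obtain k where k: "k \<in> nucleus" "rep y = y \<cdot> k" using repE assms by metis
  obtain l where l: "l \<in> nucleus" "n \<cdot> y = y \<cdot> l" using nucleus_swap n assms by blast
  have "(x \<cdot> n) \<cdot> (y \<cdot> k) = x \<cdot> (n \<cdot> (y \<cdot> k))" using n k assms by (simp add: nucleus_mid)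
  also have "n \<cdot> (y \<cdot> k) = (y \<cdot> l) \<cdot> k" using n k l assms by (simp flip: nucleus_left)
  also have "\<dots> = y \<cdot> (l \<cdot> k)" using k l assms by (simp add: nucleus_mid)
  also have "x \<cdot> (y \<cdot> (l \<cdot> k)) = (x \<cdot> y) \<cdot> (l \<cdot> k)" using k l assms by (simp add: nucleus_right nucleus_mult)
  finally show ?thesis using n(2) k(2) rep_mult[of "x \<cdot> y" "l \<cdot> k"] l k assms by (simp add: nucleus_mult)
qed

lemma rep_rep [simp]: "x \<in> Q \<Longrightarrow> rep (rep x) = rep x"
  using repE[of x] rep_mult by metis

lemma rep_hom_left: "x \<in> Q \<Longrightarrow> y \<in> Q \<Longrightarrow> rep (rep x \<cdot> y) = rep (x \<cdot> y)"
  using rep_hom[of "rep x" y] rep_hom[of x y] by simp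

lemma rep_hom_right: "x \<in> Q \<Longrightarrow> y \<in> Q \<Longrightarrow> rep (x \<cdot> rep y) = rep (x \<cdot> y)"
  using rep_hom[of x "rep y"] rep_hom[of x y] by simp

lemma finite_cml_quotient: "finite_cml (rep ` Q) (\<lambda>x y. rep (x \<cdot> y)) (rep e)"
proof
  show "finite (rep ` Q)" using finite_Q by simp
next
  fix x y z assume "x \<in> rep ` Q" "y \<in> rep ` Q" "z \<in> rep ` Q"
  then obtain a b c where abc: "x = rep a" "y = rep b" "z = rep c" "a \<in> Q" "b \<in> Q" "c \<in> Q" by blast
  then show "rep (rep (rep (x \<cdot> y) \<cdot> x) \<cdot> z) = rep (x \<cdot> rep (y \<cdot> rep (x \<cdot> z)))"
    by (simp add: rep_hom rep_hom_left rep_hom_right moufang)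
  assume "rep (x \<cdot> y) = rep (x \<cdot> z)"
  then have "rep (a \<cdot> b) = rep (a \<cdot> c)" using abc by (simp add: rep_hom)
  then obtain n where n: "n \<in> nucleus" "a \<cdot> c = (a \<cdot> b) \<cdot> n" using rep_eqD[of "a \<cdot> b" "a \<cdot> c"] abc by auto
  then have "a \<cdot> c = a \<cdot> (b \<cdot> n)" using abc by (simp add: nucleus_right)
  then have "c = b \<cdot> n" using n abc left_cancel[of a c "b \<cdot> n"] by simp
  then show "y = z" using n abc by (simp add: rep_mult)
next
  fix x y assume "x \<in> rep ` Q" "y \<in> rep ` Q"
  then obtain a b where ab: "x = rep a" "y = rep b" "a \<in> Q" "b \<in> Q" by blast
  obtain k where "k \<in> nucleus" "a \<cdot> b = (b \<cdot> a) \<cdot> k" using commutator ab by blast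
  then show "rep (x \<cdot> y) = rep (y \<cdot> x)" using ab by (simp add: rep_hom rep_mult)
qed (auto simp: rep_hom_left rep_hom_right)

theorem card_sub_dvd:
  assumes T: "T \<subseteq> Q" "e \<in> T" "\<And>x y. x \<in> T \<Longrightarrow> y \<in> T \<Longrightarrow> x \<cdot> y \<in> T"
  shows "card T dvd card Q"
proof -
  \<comment> \<open>Both the nucleus and \<open>rep\<close> are those of Q even when A is smaller,
    so that the factors for T and for Q can be compared one by one.\<close>
  have fib: "card A = card (A \<inter> nucleus) * card (rep ` A)"
    if A: "A \<subseteq> Q" "e \<in> A" "\<And>x y. x \<in> A \<Longrightarrow> y \<in> A \<Longrightarrow> x \<cdot> y \<in> A" for A
  proof (rule card_eq_fiber_mult_image)
    show "finite A" using A(1) finite_Q finite_subset by blast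
    fix a assume a: "a \<in> A"
    have aQ: "a \<in> Q" using a A by blast
    have "{x \<in> A. rep x = rep a} = m a ` (A \<inter> nucleus)"
    proof
      show "m a ` (A \<inter> nucleus) \<subseteq> {x \<in> A. rep x = rep a}"
        using a aQ A(3) by (auto simp: rep_mult)
      show "{x \<in> A. rep x = rep a} \<subseteq> m a ` (A \<inter> nucleus)"
      proof
        fix x assume x: "x \<in> {x \<in> A. rep x = rep a}"
        then have xA: "x \<in> A" and xQ: "x \<in> Q" and r: "rep a = rep x" using A(1) by auto
        obtain n where n: "n \<in> nucleus" "x = a \<cdot> n" using rep_eqD[OF aQ xQ r] by blast
        have "i a \<cdot> x \<in> A" using i_sub[OF A a] A(3) xA by blast
        then have "n \<in> A" using n aQ by simp
        then show "x \<in> m a ` (A \<inter> nucleus)" using n by blast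
      qed
    qed
    moreover have "inj_on (m a) (A \<inter> nucleus)" using aQ left_cancel by (intro inj_onI) auto
    ultimately show "card {x \<in> A. rep x = rep a} = card (A \<inter> nucleus)" by (simp add: card_image)
  qed
  interpret C: finite_cml "rep ` Q" "\<lambda>x y. rep (x \<cdot> y)" "rep e" by (rule finite_cml_quotient)
  have "card (rep ` T) dvd card (rep ` Q)"
  proof (rule C.card_sub_dvd)
    show "rep ` T \<subseteq> rep ` Q" using T(1) by blast
    show "rep e \<in> rep ` T" using T(2) by blast
    show "rep (x \<cdot> y) \<in> rep ` T" if xy: "x \<in> rep ` T" "y \<in> rep ` T" for x y
    proof -
      obtain a b where ab: "x = rep a" "y = rep b" "a \<in> T" "b \<in> T" using xy by blast
      then have "rep (x \<cdot> y) = rep (a \<cdot> b)" using T(1) by (simp add: rep_hom subset_iff)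
      then show ?thesis using ab T(3) by blast
    qed
  qed
  moreover have "card (T \<inter> nucleus) dvd card (Q \<inter> nucleus)"
  proof (rule card_submonoid_dvd[where m = m and e = e])
    show "finite (Q \<inter> nucleus)" using finite_Q by simp
    show "x \<cdot> y \<in> Q \<inter> nucleus" if "x \<in> Q \<inter> nucleus" "y \<in> Q \<inter> nucleus" for x y
      using that nucleus_mult by simp
    show "x \<cdot> y \<in> T \<inter> nucleus" if "x \<in> T \<inter> nucleus" "y \<in> T \<inter> nucleus" for x y
      using that nucleus_mult T(3) by simp
    show "(x \<cdot> y) \<cdot> z = x \<cdot> (y \<cdot> z)" if "x \<in> Q \<inter> nucleus" "y \<in> Q \<inter> nucleus" "z \<in> Q \<inter> nucleus" for x y z
      using that nucleus_mid by simp
    show "y = z" if "x \<in> Q \<inter> nucleus" "y \<in> Q \<inter> nucleus" "z \<in> Q \<inter> nucleus" "x \<cdot> y = x \<cdot> z" for x y z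
      using that left_cancel[of x y z] by simp
  qed (use T nucleus_e in auto)
  moreover have "card Q = card (Q \<inter> nucleus) * card (rep ` Q)" by (rule fib) simp_all
  ultimately show ?thesis using fib[OF T] by (simp only: mult_dvd_mono)
qed

end

section \<open>Left automorphic Moufang loops\<close>

context finite_moufang
begin

lemma ldiv_eq: assumes "a \<in> Q" "b \<in> Q" shows "ldiv Q m a b = i a \<cdot> b"
  unfolding ldiv_def using assms by (intro the_equality) auto

lemma rdiv_eq: assumes "a \<in> Q" "b \<in> Q" shows "rdiv Q m b a = b \<cdot> i a"
  unfolding rdiv_def using assms by (intro the_equality) auto

lemma subloop_iff_closed:
  "subloop Q m e T \<longleftrightarrow> T \<subseteq> Q \<and> e \<in> T \<and> (\<forall>a\<in>T. \<forall>b\<in>T. a \<cdot> b \<in> T)"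
proof
  assume T: "T \<subseteq> Q \<and> e \<in> T \<and> (\<forall>a\<in>T. \<forall>b\<in>T. a \<cdot> b \<in> T)"
  have "ldiv Q m a b \<in> T \<and> rdiv Q m a b \<in> T" if "a \<in> T" "b \<in> T" for a b
  proof -
    have "i a \<in> T" "i b \<in> T" using i_sub[of T] T that by auto
    moreover have "a \<in> Q" "b \<in> Q" using T that by auto
    ultimately show ?thesis using T that by (simp add: ldiv_eq rdiv_eq)
  qed
  then show "subloop Q m e T" using T by (simp add: subloop_def)
qed (simp add: subloop_def)

text \<open>Compare the two ways of splitting $x(y(ab)) = (xy)(\theta a\cdot\theta b)$ with the Moufang
  identity $(xax)(x^{-1}b) = x(ab)$, where $\theta = L_{xy}^{-1}L_xL_y$.\<close>

lemma commutator_in_nucleus: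
  assumes LA: "left_automorphic Q m e" and x: "x \<in> Q" and y: "y \<in> Q"
  shows "i (y \<cdot> x) \<cdot> (x \<cdot> y) \<in> nucleus"
proof -
  let ?c = "x \<cdot> y" and ?d = "i x \<cdot> i y"
  let ?k = "?d \<cdot> ?c"
  have Q: "?c \<in> Q" "?d \<in> Q" "?k \<in> Q" using x y by simp_all
  define f where "f = (\<lambda>z. ldiv Q m ?c (x \<cdot> (y \<cdot> z)))"
  have f: "f z = i ?c \<cdot> (x \<cdot> (y \<cdot> z))" if "z \<in> Q" for z
    unfolding f_def using that x y by (simp add: ldiv_eq)
  have fQ: "f z \<in> Q" if "z \<in> Q" for z using f that x y by simp
  have cf: "?c \<cdot> f z = x \<cdot> (y \<cdot> z)" if "z \<in> Q" for z using f that x y by simp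
  have fe: "f e = e" using f[of e] x y by simp
  have "f \<in> lmlt Q m" unfolding f_def using x y by (intro lmlt.intros) simp_all
  then have f_hom: "f (a \<cdot> b) = f a \<cdot> f b" if "a \<in> Q" "b \<in> Q" for a b
    using LA fe that by (auto simp: left_automorphic_def automorphism_def)
  define P where "P a = (x \<cdot> ((y \<cdot> a) \<cdot> y)) \<cdot> x" for a
  \<comment> \<open>Taking \<open>b = y (x w)\<close> makes the second factor on the Moufang side
    equal to w itself; \<open>s w\<close> is the corresponding factor on the inner mapping
    side.\<close>
  define s where "s w = i ?c \<cdot> f (y \<cdot> (x \<cdot> w))" for w
  have key: "P a \<cdot> w = ((?c \<cdot> f a) \<cdot> ?c) \<cdot> s w" if a: "a \<in> Q" and w: "w \<in> Q" for a w
  proof -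
    let ?b = "y \<cdot> (x \<cdot> w)"
    have b: "?b \<in> Q" using w x y by simp
    have "x \<cdot> (y \<cdot> (a \<cdot> ?b)) = x \<cdot> (((y \<cdot> a) \<cdot> y) \<cdot> (i y \<cdot> ?b))"
      using moufang_split[of y a ?b] a b y by simp
    also have "\<dots> = P a \<cdot> (i x \<cdot> (i y \<cdot> ?b))"
      using moufang_split[of x "(y \<cdot> a) \<cdot> y" "i y \<cdot> ?b"] a b x y by (simp add: P_def)
    also have "\<dots> = P a \<cdot> w" using w x y by simp
    finally have 1: "P a \<cdot> w = ?c \<cdot> (f a \<cdot> f ?b)" using cf[of "a \<cdot> ?b"] f_hom[OF a b] a b by simp
    show ?thesis unfolding 1 s_def
      using moufang_split[of ?c "f a" "f ?b"] fQ[OF a] fQ[OF b] Q(1) by simp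
  qed
  have sQ: "s w \<in> Q" if "w \<in> Q" for w using that fQ x y by (simp add: s_def)
  have s_d: "s ?d = i ?c"
  proof -
    have "y \<cdot> (x \<cdot> ?d) = e" using x y by simp
    then show ?thesis using fe Q(1) by (simp add: s_def)
  qed
  \<comment> \<open>The witness \<open>?a\<close> inverts P. At w = \<open>?d\<close> the value of s
    is \<open>i ?c\<close>, and this identifies the remaining unknown factor
    \<open>(?c f a) ?c\<close> as \<open>(p ?d) ?c\<close>.\<close>
  have pw: "p \<cdot> w = ((p \<cdot> ?d) \<cdot> ?c) \<cdot> s w" if p: "p \<in> Q" and w: "w \<in> Q" for p w
  proof -
    let ?a = "i y \<cdot> ((i x \<cdot> (p \<cdot> i x)) \<cdot> i y)"
    have a: "?a \<in> Q" and Pa: "P ?a = p" using p x y by (simp_all add: P_def)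
    have r: "(?c \<cdot> f ?a) \<cdot> ?c \<in> Q" using fQ[OF a] Q(1) by simp
    have "p \<cdot> ?d = ((?c \<cdot> f ?a) \<cdot> ?c) \<cdot> i ?c" using key[OF a Q(2)] s_d Pa by simp
    then have "(p \<cdot> ?d) \<cdot> ?c = (?c \<cdot> f ?a) \<cdot> ?c" using r Q(1) by simp
    then show ?thesis using key[OF a w] Pa by simp
  qed
  \<comment> \<open>Specialising p to e determines s, and specialising w to \<open>?k\<close>, where
    s is e, gives \<open>p ?k\<close>. What is left, \<open>p w = (p ?k) (i ?k w)\<close>, is
    nuclearity of \<open>?k\<close>.\<close>
  have s: "s w = i ?k \<cdot> w" if "w \<in> Q" for w
  proof -
    have "w = ?k \<cdot> s w" using pw[of e w] that Q by simp
    then show ?thesis using i_cancel[OF Q(3) sQ[OF that]] by simp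
  qed
  have pk: "p \<cdot> ?k = (p \<cdot> ?d) \<cdot> ?c" if "p \<in> Q" for p
    using pw[OF that Q(3)] s[OF Q(3)] that Q by simp
  have "(p \<cdot> ?k) \<cdot> w = p \<cdot> (?k \<cdot> w)" if "p \<in> Q" "w \<in> Q" for p w
    using pw[of p "?k \<cdot> w"] s[of "?k \<cdot> w"] pk[OF that(1)] that Q by simp
  then have "?k \<in> nucleus" using Q(3) unfolding nucleus_def by blast
  then show ?thesis using x y by (simp add: i_mult)
qed

text \<open>Left automorphy is used in Q, where the commutator becomes nuclear; the commutator lies
  in S, and associating with all of Q restricts to S.\<close>

lemma nuclear_commutators_subloop:
  assumes LA: "left_automorphic Q m e" and S: "subloop Q m e S"
  shows "nuclear_commutators S m e"
proof -
  have cl: "S \<subseteq> Q" "e \<in> S" "\<And>a b. a \<in> S \<Longrightarrow> b \<in> S \<Longrightarrow> a \<cdot> b \<in> S"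
    using S by (auto simp: subloop_iff_closed)
  interpret S: finite_moufang S m e using finite_moufang_sub[OF cl] .
  show ?thesis
  proof
    fix x y assume xy: "x \<in> S" "y \<in> S"
    then have Q: "x \<in> Q" "y \<in> Q" using cl(1) by auto
    let ?k = "i (y \<cdot> x) \<cdot> (x \<cdot> y)"
    have "?k \<in> S" using i_sub[OF cl] cl(3) xy by blast
    moreover have "(a \<cdot> ?k) \<cdot> b = a \<cdot> (?k \<cdot> b)" if "a \<in> S" "b \<in> S" for a b
      using nucleus_mid[OF commutator_in_nucleus[OF LA Q]] that cl(1) by blast
    ultimately have "?k \<in> S.nucleus" unfolding S.nucleus_def by blast
    moreover have "x \<cdot> y = (y \<cdot> x) \<cdot> ?k" using Q by simp
    ultimately show "\<exists>k\<in>S.nucleus. x \<cdot> y = (y \<cdot> x) \<cdot> k" by blast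
  qed
qed

lemma lcoset_inter_subloop:
  assumes LA: "left_automorphic Q m e" and S: "subloop Q m e S" and xy: "x \<in> Q" "y \<in> Q"
    and ne: "lcoset m x S \<inter> lcoset m y S \<noteq> {}"
  shows "\<exists>T. subloop Q m e T \<and> T \<subseteq> S \<and> card (lcoset m x S \<inter> lcoset m y S) = card T"
proof -
  have cl: "S \<subseteq> Q" "e \<in> S" "\<And>a b. a \<in> S \<Longrightarrow> b \<in> S \<Longrightarrow> a \<cdot> b \<in> S"
    using S by (auto simp: subloop_iff_closed)
  have SQ: "a \<in> Q" if "a \<in> S" for a using that cl(1) by blast
  obtain s t where st: "s \<in> S" "t \<in> S" "x \<cdot> s = y \<cdot> t" using ne by (auto simp: lcoset_def)
  let ?z = "x \<cdot> s"
  have zQ: "?z \<in> Q" using xy st SQ by simp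
  define f where "f v r = (\<lambda>a. ldiv Q m ?z (v \<cdot> (r \<cdot> a)))" for v r
  have f: "f v r a = i ?z \<cdot> (v \<cdot> (r \<cdot> a))" if "v \<in> Q" "r \<in> Q" "a \<in> Q" for v r a
    unfolding f_def using that zQ by (simp add: ldiv_eq)
  have hom: "f v r (a \<cdot> b) = f v r a \<cdot> f v r b"
    if vr: "v \<in> Q" "r \<in> Q" "v \<cdot> r = ?z" and ab: "a \<in> Q" "b \<in> Q" for v r a b
  proof -
    have "f v r \<in> lmlt Q m" unfolding f_def using vr zQ by (intro lmlt.intros) simp_all
    moreover have "f v r e = e" using f[of v r e] vr zQ by simp
    ultimately show ?thesis using LA ab by (auto simp: left_automorphic_def automorphism_def)
  qed
  have eq_iff: "f x s a = f y t b \<longleftrightarrow> x \<cdot> (s \<cdot> a) = y \<cdot> (t \<cdot> b)" if "a \<in> Q" "b \<in> Q" for a b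
    using that f[of x s a] f[of y t b] xy st SQ zQ by (simp add: cancel_iff)
  define T where "T = {a \<in> S. \<exists>b\<in>S. f x s a = f y t b}"
  have "subloop Q m e T"
    unfolding subloop_iff_closed
  proof (intro conjI ballI)
    show "T \<subseteq> Q" using cl(1) by (auto simp: T_def)
    have "f x s e = f y t e" using eq_iff[of e e] st SQ xy by simp
    then show "e \<in> T" unfolding T_def using cl(2) by blast
    fix a b assume "a \<in> T" "b \<in> T"
    then obtain a' b' where ab: "a \<in> S" "b \<in> S" "a' \<in> S" "b' \<in> S" "f x s a = f y t a'" "f x s b = f y t b'"
      by (auto simp: T_def)
    have "f x s (a \<cdot> b) = f y t (a' \<cdot> b')"
      using hom[of x s a b] hom[of y t a' b'] ab st xy SQ by simp
    then show "a \<cdot> b \<in> T" unfolding T_def using ab cl(3) by blast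
  qed
  moreover have "T \<subseteq> S" by (auto simp: T_def)
  moreover have "lcoset m x S \<inter> lcoset m y S = (\<lambda>a. x \<cdot> (s \<cdot> a)) ` T"
  proof
    show "(\<lambda>a. x \<cdot> (s \<cdot> a)) ` T \<subseteq> lcoset m x S \<inter> lcoset m y S"
    proof
      fix w assume "w \<in> (\<lambda>a. x \<cdot> (s \<cdot> a)) ` T"
      then obtain a b where ab: "a \<in> S" "b \<in> S" "f x s a = f y t b" "w = x \<cdot> (s \<cdot> a)" by (auto simp: T_def)
      then have "w = y \<cdot> (t \<cdot> b)" using eq_iff[of a b] SQ by simp
      moreover have "s \<cdot> a \<in> S" "t \<cdot> b \<in> S" using ab st cl(3) by auto
      ultimately show "w \<in> lcoset m x S \<inter> lcoset m y S" using ab unfolding lcoset_def by blast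
    qed
    show "lcoset m x S \<inter> lcoset m y S \<subseteq> (\<lambda>a. x \<cdot> (s \<cdot> a)) ` T"
    proof
      fix w assume "w \<in> lcoset m x S \<inter> lcoset m y S"
      then obtain a b where ab: "a \<in> S" "b \<in> S" "w = x \<cdot> a" "w = y \<cdot> b" by (auto simp: lcoset_def)
      \<comment> \<open>Every element of S is s times an element of S and also t times one, so a
        point of the intersection can be written in the form that \<open>eq_iff\<close>
        compares.\<close>
      have iS: "i s \<cdot> a \<in> S" "i t \<cdot> b \<in> S" using i_sub[OF cl] cl(3) st ab by auto
      have "x \<cdot> (s \<cdot> (i s \<cdot> a)) = y \<cdot> (t \<cdot> (i t \<cdot> b))" using ab st SQ by simp
      then have "f x s (i s \<cdot> a) = f y t (i t \<cdot> b)" using eq_iff iS SQ by blast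
      then have "i s \<cdot> a \<in> T" unfolding T_def using iS by blast
      moreover have "w = x \<cdot> (s \<cdot> (i s \<cdot> a))" using ab st SQ by simp
      ultimately show "w \<in> (\<lambda>a. x \<cdot> (s \<cdot> a)) ` T" by blast
    qed
  qed
  moreover have "inj_on (\<lambda>a. x \<cdot> (s \<cdot> a)) T"
    using xy st SQ by (intro inj_onI) (simp add: T_def cancel_iff)
  ultimately show ?thesis using card_image by metis
qed

end

lemma finite_moufang_loop:
  assumes "loop Q m e" "finite Q" "moufang Q m"
  shows "finite_moufang Q m e"
proof
  show "y = z" if "x \<in> Q" "y \<in> Q" "z \<in> Q" "m x y = m x z" for x y z
  proof -
    have "\<exists>!w. w \<in> Q \<and> m x w = m x z" using assms(1) that by (simp add: loop_def)
    then show ?thesis using that by blast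
  qed
qed (use assms in \<open>auto simp: loop_def moufang_def\<close>)

theorem theorem6p8:
  fixes Q :: "'a set" and m :: "'a \<Rightarrow> 'a \<Rightarrow> 'a" and e :: 'a
    and S :: "'a set" and x y :: 'a
  assumes "loop Q m e" and "finite Q" and "moufang Q m" and "left_automorphic Q m e"
    and "subloop Q m e S" and "x \<in> Q" and "y \<in> Q"
    and "lcoset m x S \<inter> lcoset m y S \<noteq> {}"
  shows "(\<exists>T. subloop Q m e T \<and> T \<subseteq> S \<and> card (lcoset m x S \<inter> lcoset m y S) = card T)
         \<and> card (lcoset m x S \<inter> lcoset m y S) dvd card S"
proof -
  interpret finite_moufang Q m e using finite_moufang_loop assms(1-3) .
  obtain T where T: "subloop Q m e T" "T \<subseteq> S" "card (lcoset m x S \<inter> lcoset m y S) = card T"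
    using lcoset_inter_subloop assms(4-8) by blast
  interpret S: nuclear_commutators S m e using nuclear_commutators_subloop assms(4,5) .
  have "card T dvd card S"
    using T(1,2) by (intro S.card_sub_dvd) (auto simp: subloop_iff_closed)
  then show ?thesis using T by metis
qed

end
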